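(* Let $(\Omega,\Sigma)$ be a measurable space. Every $B(\Omega)$-module $L_p(\Omega,\mu)$, with $p\in[1,+\infty]$ and $\mu\in M(\Omega)$, is relatively flat, metrically flat and extremely flat in the category $\mathscr{L}$.
   Context: All linear spaces are over $\mathbb{C}$. $B(\Omega)$ is the Banach algebra of bounded measurable functions on $(\Omega,\Sigma)$ with the sup-norm. $M(\Omega)$ is the space of finite complex-valued $\sigma$-additive measures on $(\Omega,\Sigma)$; for complex $\mu$, $L_p(\Omega,\mu)$ is understood as $L_p(\Omega,|\mu|)$. Each $L_p(\Omega,\mu)$ is a left and a right Banach $B(\Omega)$-module under pointwise multiplication ($b\cdot f=f\cdot b$). $\mathscr{L}$ is the full subcategory of the category of left Banach $B(\Omega)$-modules (morphisms: bounded $B(\Omega)$-module maps) whose objects are the modules $L_p(\Omega,\mu)$, $p\in[1,+\infty]$, $\mu\in M(\Omega)$. $\mathscr{L}^{\operatorname{op}}$ is the analogous category of right $B(\Omega)$-modules of the form $L_p(\Omega,\mu)$. An operator $T:X\to Y$ between normed spaces is topologically injective if it is bounded and $\|T(x)\|\geq c\|x\|$ for some $c>0$ and all $x\in X$; isometric if $\|T(x)\|=\|x\|$ for all $x\in X$. A morphism is a relatively / metrically / extremely admissible monomorphism if it is topologically injective / isometric / isometric, respectively. $X\otimes^{B(\Omega)}F$ denotes the projective Banach module tensor product of a right module $X$ and a left module $F$ over $B(\Omega)$, i.e. the quotient of the projective tensor product $X\hat\otimes F$ by the closed linear span of the elements $x\cdot b\otimes f-x\otimes b\cdot f$. An object $F$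 of $\mathscr{L}$ is relatively / metrically / extremely flat in $\mathscr{L}$ if for every relatively / metrically / extremely admissible monomorphism $i:X\to Y$ in $\mathscr{L}^{\operatorname{op}}$, the operator $i\otimes^{B(\Omega)}1_F:X\otimes^{B(\Omega)}F\to Y\otimes^{B(\Omega)}F$ is topologically injective / isometric / isometric, respectively. *)

theory Defs
  imports
    "HOL-Probability.Essential_Supremum"
    "HOL-Library.Poly_Mapping"
    "HOL-Library.FuncSet"
    "HOL.Hull"
begin

section \<open>Complex (semi)normed spaces with explicit carrier\<close>

text \<open>
  The modules L_p depend on a measure, so they cannot be types. The operations are meaningful on
  the carrier only.
\<close>

record 'v nspace =
  car :: "'v set"
  vzero :: 'v
  vadd :: "'v \<Rightarrow> 'v \<Rightarrow> 'v"
  vscale :: "complex \<Rightarrow> 'v \<Rightarrow> 'v"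
  vnorm :: "'v \<Rightarrow> real"

definition vminus :: "('v, 'm) nspace_scheme \<Rightarrow> 'v \<Rightarrow> 'v \<Rightarrow> 'v"
  where "vminus V u v = vadd V u (vscale V (-1) v)"

definition lin_subspace :: "('v, 'm) nspace_scheme \<Rightarrow> 'v set \<Rightarrow> bool"
  where "lin_subspace V W \<longleftrightarrow> W \<subseteq> car V \<and> vzero V \<in> W
    \<and> (\<forall>u\<in>W. \<forall>v\<in>W. vadd V u v \<in> W) \<and> (\<forall>c. \<forall>v\<in>W. vscale V c v \<in> W)"

definition norm_closed :: "('v, 'm) nspace_scheme \<Rightarrow> 'v set \<Rightarrow> bool"
  where "norm_closed V W \<longleftrightarrow> (\<forall>s v. (\<forall>n::nat. s n \<in> W) \<and> v \<in> car V
      \<and> (\<lambda>n. vnorm V (vminus V (s n) v)) \<longlonglongrightarrow> 0 \<longrightarrow> v \<in> W)"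

definition lin_span :: "('v, 'm) nspace_scheme \<Rightarrow> 'v set \<Rightarrow> 'v set"
  where "lin_span V S = lin_subspace V hull S"

definition closed_lin_span :: "('v, 'm) nspace_scheme \<Rightarrow> 'v set \<Rightarrow> 'v set"
  where "closed_lin_span V S = (\<lambda>W. lin_subspace V W \<and> norm_closed V W) hull S"

definition vcoset :: "('v, 'm) nspace_scheme \<Rightarrow> 'v set \<Rightarrow> 'v \<Rightarrow> 'v set"
  where "vcoset V N v = vadd V v ` N"

text \<open>
  Quotient by a linear subspace with the usual quotient (semi)norm. The unions are over
  representatives and collapse to a single coset.
\<close>

definition quot_space :: "('v, 'm) nspace_scheme \<Rightarrow> 'v set \<Rightarrow> 'v set nspace"
  where "quot_space V N =
    \<lparr> car = vcoset V N ` car V,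
      vzero = vcoset V N (vzero V),
      vadd = (\<lambda>A B. \<Union>a\<in>A. \<Union>b\<in>B. vcoset V N (vadd V a b)),
      vscale = (\<lambda>c A. \<Union>a\<in>A. vcoset V N (vscale V c a)),
      vnorm = (\<lambda>A. Inf (vnorm V ` A)) \<rparr>"

definition cauchy_space :: "('v, 'm) nspace_scheme \<Rightarrow> (nat \<Rightarrow> 'v) nspace"
  where "cauchy_space V =
    \<lparr> car = {s. (\<forall>n. s n \<in> car V)
        \<and> (\<forall>e>0. \<exists>n0. \<forall>m\<ge>n0. \<forall>n\<ge>n0. vnorm V (vminus V (s m) (s n)) < e)},
      vzero = (\<lambda>_. vzero V),
      vadd = (\<lambda>s t n. vadd V (s n) (t n)),
      vscale = (\<lambda>c s n. vscale V c (s n)),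
      vnorm = (\<lambda>s. lim (\<lambda>n. vnorm V (s n))) \<rparr>"

definition null_seqs :: "('v, 'm) nspace_scheme \<Rightarrow> (nat \<Rightarrow> 'v) set"
  where "null_seqs V = {s \<in> car (cauchy_space V). (\<lambda>n. vnorm V (s n)) \<longlonglongrightarrow> 0}"

definition completion :: "('v, 'm) nspace_scheme \<Rightarrow> (nat \<Rightarrow> 'v) set nspace"
  where "completion V = quot_space (cauchy_space V) (null_seqs V)"

definition to_completion :: "('v, 'm) nspace_scheme \<Rightarrow> 'v \<Rightarrow> (nat \<Rightarrow> 'v) set"
  where "to_completion V v = vcoset (cauchy_space V) (null_seqs V) (\<lambda>_. v)"

section \<open>Operators\<close>

definition linear_operator ::
    "('v, 'm) nspace_scheme \<Rightarrow> ('w, 'n) nspace_scheme \<Rightarrow> ('v \<Rightarrow> 'w) \<Rightarrow> bool"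
  where "linear_operator V W T \<longleftrightarrow> T \<in> car V \<rightarrow> car W
    \<and> (\<forall>u\<in>car V. \<forall>v\<in>car V. T (vadd V u v) = vadd W (T u) (T v))
    \<and> (\<forall>c. \<forall>v\<in>car V. T (vscale V c v) = vscale W c (T v))"

definition bounded_operator ::
    "('v, 'm) nspace_scheme \<Rightarrow> ('w, 'n) nspace_scheme \<Rightarrow> ('v \<Rightarrow> 'w) \<Rightarrow> bool"
  where "bounded_operator V W T \<longleftrightarrow> linear_operator V W T
    \<and> (\<exists>K. \<forall>v\<in>car V. vnorm W (T v) \<le> K * vnorm V v)"

definition topologically_injective ::
    "('v, 'm) nspace_scheme \<Rightarrow> ('w, 'n) nspace_scheme \<Rightarrow> ('v \<Rightarrow> 'w) \<Rightarrow> bool"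
  where "topologically_injective V W T \<longleftrightarrow> bounded_operator V W T
    \<and> (\<exists>c>0. \<forall>v\<in>car V. vnorm W (T v) \<ge> c * vnorm V v)"

definition isometric_operator ::
    "('v, 'm) nspace_scheme \<Rightarrow> ('w, 'n) nspace_scheme \<Rightarrow> ('v \<Rightarrow> 'w) \<Rightarrow> bool"
  where "isometric_operator V W T \<longleftrightarrow> linear_operator V W T
    \<and> (\<forall>v\<in>car V. vnorm W (T v) = vnorm V v)"

section \<open>Projective tensor product\<close>

definition free_space ::
    "('x, 'm) nspace_scheme \<Rightarrow> ('y, 'n) nspace_scheme \<Rightarrow> ('x \<times> 'y \<Rightarrow>\<^sub>0 complex) nspace"
  where "free_space X Y =
    \<lparr> car = {u. Poly_Mapping.keys u \<subseteq> car X \<times> car Y},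
      vzero = 0,
      vadd = (+),
      vscale = (\<lambda>c. Poly_Mapping.map ((*) c)),
      vnorm = (\<lambda>u. \<Sum>(x, y)\<in>Poly_Mapping.keys u.
        cmod (Poly_Mapping.lookup u (x, y)) * vnorm X x * vnorm Y y) \<rparr>"

definition pure :: "'x \<Rightarrow> 'y \<Rightarrow> ('x \<times> 'y \<Rightarrow>\<^sub>0 complex)"
  where "pure x y = Poly_Mapping.single (x, y) 1"

definition bilinear_relations ::
    "('x, 'm) nspace_scheme \<Rightarrow> ('y, 'n) nspace_scheme \<Rightarrow> ('x \<times> 'y \<Rightarrow>\<^sub>0 complex) set"
  where "bilinear_relations X Y =
      {pure (vadd X x x') y - pure x y - pure x' y | x x' y.
        x \<in> car X \<and> x' \<in> car X \<and> y \<in> car Y}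
    \<union> {pure x (vadd Y y y') - pure x y - pure x y' | x y y'.
        x \<in> car X \<and> y \<in> car Y \<and> y' \<in> car Y}
    \<union> {pure (vscale X c x) y - vscale (free_space X Y) c (pure x y) | c x y.
        x \<in> car X \<and> y \<in> car Y}
    \<union> {pure x (vscale Y c y) - vscale (free_space X Y) c (pure x y) | c x y.
        x \<in> car X \<and> y \<in> car Y}"

text \<open>
  The quotient norm of a tensor is the infimum of sum |c_k| |x_k| |y_k| over all its
  representations sum c_k (x_k tensor y_k), i.e. the projective norm.
\<close>

definition alg_tensor :: "('x, 'm) nspace_scheme \<Rightarrow> ('y, 'n) nspace_scheme
    \<Rightarrow> ('x \<times> 'y \<Rightarrow>\<^sub>0 complex) set nspace"
  where "alg_tensor X Y =
    quot_space (free_space X Y) (lin_span (free_space X Y) (bilinear_relations X Y))"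

definition alg_pure :: "('x, 'm) nspace_scheme \<Rightarrow> ('y, 'n) nspace_scheme \<Rightarrow> 'x \<Rightarrow> 'y
    \<Rightarrow> ('x \<times> 'y \<Rightarrow>\<^sub>0 complex) set"
  where "alg_pure X Y x y =
    vcoset (free_space X Y) (lin_span (free_space X Y) (bilinear_relations X Y)) (pure x y)"

type_synonym ('x, 'y) ptensor = "(nat \<Rightarrow> ('x \<times> 'y \<Rightarrow>\<^sub>0 complex) set) set"

definition proj_tensor ::
    "('x, 'm) nspace_scheme \<Rightarrow> ('y, 'n) nspace_scheme \<Rightarrow> ('x, 'y) ptensor nspace"
  where "proj_tensor X Y = completion (alg_tensor X Y)"

definition proj_pure ::
    "('x, 'm) nspace_scheme \<Rightarrow> ('y, 'n) nspace_scheme \<Rightarrow> 'x \<Rightarrow> 'y \<Rightarrow> ('x, 'y) ptensor"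
  where "proj_pure X Y x y = to_completion (alg_tensor X Y) (alg_pure X Y x y)"

section \<open>Modules over a commutative algebra of functions\<close>

text \<open>
  The algebra acts by pointwise multiplication and is given by its set \<open>B\<close> of elements.
  \<open>act X b x\<close> is read as b.x when X is used as a left module and as x.b when it is used
  as a right module.
\<close>

record ('b, 'v) bmodule = "'v nspace" +
  act :: "'b \<Rightarrow> 'v \<Rightarrow> 'v"

definition module_map :: "'b set \<Rightarrow> ('b, 'v) bmodule \<Rightarrow> ('b, 'w) bmodule \<Rightarrow> ('v \<Rightarrow> 'w) \<Rightarrow> bool"
  where "module_map B X Y T \<longleftrightarrow> bounded_operator X Y T
    \<and> (\<forall>b\<in>B. \<forall>x\<in>car X. T (act X b x) = act Y b (T x))"

definition balancing_span ::
    "'b set \<Rightarrow> ('b, 'x) bmodule \<Rightarrow> ('b, 'y) bmodule \<Rightarrow> ('x, 'y) ptensor set"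
  where "balancing_span B X F = closed_lin_span (proj_tensor X F)
    {vminus (proj_tensor X F) (proj_pure X F (act X b x) f) (proj_pure X F x (act F b f)) | b x f.
      b \<in> B \<and> x \<in> car X \<and> f \<in> car F}"

definition module_tensor ::
    "'b set \<Rightarrow> ('b, 'x) bmodule \<Rightarrow> ('b, 'y) bmodule \<Rightarrow> ('x, 'y) ptensor set nspace"
  where "module_tensor B X F = quot_space (proj_tensor X F) (balancing_span B X F)"

definition module_pure ::
    "'b set \<Rightarrow> ('b, 'x) bmodule \<Rightarrow> ('b, 'y) bmodule \<Rightarrow> 'x \<Rightarrow> 'y \<Rightarrow> ('x, 'y) ptensor set"
  where "module_pure B X F x f = vcoset (proj_tensor X F) (balancing_span B X F) (proj_pure X F x f)"

text \<open>The tensor product of module maps: the bounded operator with x tensor f mapped to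
  S x tensor T f. Extensionality makes it unique as a HOL function.\<close>

definition tensor_map :: "'b set \<Rightarrow> ('b, 'x) bmodule \<Rightarrow> ('b, 'f) bmodule
    \<Rightarrow> ('b, 'y) bmodule \<Rightarrow> ('b, 'g) bmodule \<Rightarrow> ('x \<Rightarrow> 'y) \<Rightarrow> ('f \<Rightarrow> 'g)
    \<Rightarrow> ('x, 'f) ptensor set \<Rightarrow> ('y, 'g) ptensor set"
  where "tensor_map B X F Y G S T = (THE R. R \<in> extensional (car (module_tensor B X F))
    \<and> bounded_operator (module_tensor B X F) (module_tensor B Y G) R
    \<and> (\<forall>x\<in>car X. \<forall>f\<in>car F. R (module_pure B X F x f) = module_pure B Y G (S x) (T f)))"

section \<open>Flatness in a full subcategory\<close>

text \<open>\<open>L\<close> is the set of objects (left modules) and \<open>Lop\<close> that of the opposite category (right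
  modules); the morphisms are all module maps.\<close>

definition relatively_flat ::
    "'b set \<Rightarrow> ('b, 'f) bmodule set \<Rightarrow> ('b, 'x) bmodule set \<Rightarrow> ('b, 'f) bmodule \<Rightarrow> bool"
  where "relatively_flat B L Lop F \<longleftrightarrow> F \<in> L \<and>
    (\<forall>X\<in>Lop. \<forall>Y\<in>Lop. \<forall>i. module_map B X Y i \<and> topologically_injective X Y i \<longrightarrow>
      topologically_injective (module_tensor B X F) (module_tensor B Y F)
        (tensor_map B X F Y F i (\<lambda>f. f)))"

definition metrically_flat ::
    "'b set \<Rightarrow> ('b, 'f) bmodule set \<Rightarrow> ('b, 'x) bmodule set \<Rightarrow> ('b, 'f) bmodule \<Rightarrow> bool"
  where "metrically_flat B L Lop F \<longleftrightarrow> F \<in> L \<and>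
    (\<forall>X\<in>Lop. \<forall>Y\<in>Lop. \<forall>i. module_map B X Y i \<and> isometric_operator X Y i \<longrightarrow>
      isometric_operator (module_tensor B X F) (module_tensor B Y F)
        (tensor_map B X F Y F i (\<lambda>f. f)))"

text \<open>For monomorphisms the extreme and the metric notions of admissibility coincide.\<close>

definition extremely_flat ::
    "'b set \<Rightarrow> ('b, 'f) bmodule set \<Rightarrow> ('b, 'x) bmodule set \<Rightarrow> ('b, 'f) bmodule \<Rightarrow> bool"
  where "extremely_flat B L Lop F \<longleftrightarrow> F \<in> L \<and>
    (\<forall>X\<in>Lop. \<forall>Y\<in>Lop. \<forall>i. module_map B X Y i \<and> isometric_operator X Y i \<longrightarrow>
      isometric_operator (module_tensor B X F) (module_tensor B Y F)
        (tensor_map B X F Y F i (\<lambda>f. f)))"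

section \<open>Complex measures and the modules L_p\<close>

text \<open>Only the values on \<open>\<Sigma>\<close> matter.\<close>

definition complex_measures :: "'a set \<Rightarrow> 'a set set \<Rightarrow> ('a set \<Rightarrow> complex) set"
  where "complex_measures \<Omega> \<Sigma> = {\<mu>. \<mu> {} = 0
    \<and> (\<forall>A::nat \<Rightarrow> 'a set. range A \<subseteq> \<Sigma> \<and> disjoint_family A \<longrightarrow> (\<lambda>n. \<mu> (A n)) sums \<mu> (\<Union>n. A n))}"

definition variation :: "'a set set \<Rightarrow> ('a set \<Rightarrow> complex) \<Rightarrow> 'a set \<Rightarrow> ennreal"
  where "variation \<Sigma> \<mu> E =
    (SUP A\<in>{A::nat \<Rightarrow> 'a set. range A \<subseteq> \<Sigma> \<and> disjoint_family A \<and> (\<Union>n. A n) = E}.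
      suminf (\<lambda>n. ennreal (cmod (\<mu> (A n)))))"

definition variation_measure :: "'a set \<Rightarrow> 'a set set \<Rightarrow> ('a set \<Rightarrow> complex) \<Rightarrow> 'a measure"
  where "variation_measure \<Omega> \<Sigma> \<mu> = measure_of \<Omega> \<Sigma> (variation \<Sigma> \<mu>)"

text \<open>Functions on \<open>\<Omega>\<close> are represented by their extension by zero.\<close>

definition bounded_measurable :: "'a set \<Rightarrow> 'a set set \<Rightarrow> ('a \<Rightarrow> complex) set"
  where "bounded_measurable \<Omega> \<Sigma> = {b \<in> borel_measurable (sigma \<Omega> \<Sigma>).
    bounded (b ` \<Omega>) \<and> (\<forall>x. x \<notin> \<Omega> \<longrightarrow> b x = 0)}"

text \<open>The space of p-integrable (for p infinite: essentially bounded) functions, with its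
  seminorm. Values outside the space of the measure are irrelevant: they disappear in the
  quotient by the functions vanishing almost everywhere.\<close>

definition pre_Lp :: "'a measure \<Rightarrow> ennreal \<Rightarrow> ('a \<Rightarrow> complex) nspace"
  where "pre_Lp M p =
    \<lparr> car = {f \<in> borel_measurable M.
        if p = \<infinity> then esssup M (\<lambda>x. ennreal (cmod (f x))) < \<infinity>
        else integrable M (\<lambda>x. cmod (f x) powr enn2real p)},
      vzero = (\<lambda>_. 0),
      vadd = (\<lambda>f g x. f x + g x),
      vscale = (\<lambda>c f x. c * f x),
      vnorm = (\<lambda>f. if p = \<infinity> then enn2real (esssup M (\<lambda>x. ennreal (cmod (f x))))
        else (LINT x|M. cmod (f x) powr enn2real p) powr (1 / enn2real p)) \<rparr>"

definition ae_null :: "'a measure \<Rightarrow> ennreal \<Rightarrow> ('a \<Rightarrow> complex) set"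
  where "ae_null M p = {f \<in> car (pre_Lp M p). AE x in M. f x = 0}"

definition Lp_of_measure :: "'a measure \<Rightarrow> ennreal \<Rightarrow> ('a \<Rightarrow> complex, ('a \<Rightarrow> complex) set) bmodule"
  where "Lp_of_measure M p = nspace.extend (quot_space (pre_Lp M p) (ae_null M p))
    (bmodule.fields (\<lambda>b A. \<Union>f\<in>A. vcoset (pre_Lp M p) (ae_null M p) (\<lambda>x. b x * f x)))"

definition Lp :: "'a set \<Rightarrow> 'a set set \<Rightarrow> ennreal \<Rightarrow> ('a set \<Rightarrow> complex)
    \<Rightarrow> ('a \<Rightarrow> complex, ('a \<Rightarrow> complex) set) bmodule"
  where "Lp \<Omega> \<Sigma> p \<mu> = Lp_of_measure (variation_measure \<Omega> \<Sigma> \<mu>) p"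

text \<open>As the algebra is commutative and the left and right actions agree, the same records
  serve as the objects of the category of right modules.\<close>

definition Lp_modules :: "'a set \<Rightarrow> 'a set set
    \<Rightarrow> ('a \<Rightarrow> complex, ('a \<Rightarrow> complex) set) bmodule set"
  where "Lp_modules \<Omega> \<Sigma> = {Lp \<Omega> \<Sigma> p \<mu> | p \<mu>. 1 \<le> p \<and> \<mu> \<in> complex_measures \<Omega> \<Sigma>}"

end

theory Submission
  imports Defs
begin

text \<open>
  Every admissible monomorphism between the modules has a left inverse in the category, whose norm
  is at most 1 in the isometric case. Left inverses survive tensoring with any module, so they give
  the lower bound that flatness asks for.

  Let i be a morphism from L_p(M) to L_q(N). It is multiplication by the function g that it assigns
  to the constant function 1 (lemma Lp_morphism_is_multiplication). Suppose that c times the norm of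
  f is at most the norm of i(f) for all f. The candidate for the left inverse is the division of h
  by g, with value zero where g vanishes. If f is a truncation of h/g, so that f is bounded and lies
  in L_p(M), then i(f) = f g is dominated by h, whence the norm of f is at most 1/c times the norm
  of h. Monotone convergence extends this estimate to h/g itself. As i annihilates the indicator of
  the zeros of g, these zeros are a null set for M, and dividing f g by g returns f (lemma
  Lp_morphism_left_inverse). The exponents p and q enter only through domination and monotone
  convergence, which hold for finite and infinite exponents alike.

  The rest is the functoriality of the projective module tensor product with control of the norms
  (lemmas tensor_map_props and tensor_map_of_retract): an operator with bound K extends through the
  free space, the projective norm, the completion and the quotient by the balancing relations with
  the same bound K, and it is determined by its values on elementary tensors because these span a
  dense subspace and the quotient by a closed subspace has a definite norm. Bounded functions belong
  to all the spaces because the variation of a complex measure is finite (lemma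
  finite_variation_measure).
\<close>

section \<open>Seminormed spaces and their quotients\<close>

locale vspace =
  fixes V :: "('v, 'm) nspace_scheme"
  assumes zero_in: "vzero V \<in> car V"
    and add_in: "\<lbrakk>u \<in> car V; v \<in> car V\<rbrakk> \<Longrightarrow> vadd V u v \<in> car V"
    and scale_in: "v \<in> car V \<Longrightarrow> vscale V c v \<in> car V"
    and add_assoc: "\<lbrakk>u \<in> car V; v \<in> car V; w \<in> car V\<rbrakk> \<Longrightarrow>
      vadd V (vadd V u v) w = vadd V u (vadd V v w)"
    and add_commute: "\<lbrakk>u \<in> car V; v \<in> car V\<rbrakk> \<Longrightarrow> vadd V u v = vadd V v u"
    and zero_add: "v \<in> car V \<Longrightarrow> vadd V (vzero V) v = v"
    and scale_zero: "v \<in> car V \<Longrightarrow> vscale V 0 v = vzero V"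
    and scale_one: "v \<in> car V \<Longrightarrow> vscale V 1 v = v"
    and scale_scale: "v \<in> car V \<Longrightarrow> vscale V a (vscale V b v) = vscale V (a * b) v"
    and scale_add_left: "v \<in> car V \<Longrightarrow> vscale V (a + b) v = vadd V (vscale V a v) (vscale V b v)"
    and scale_add_right: "\<lbrakk>u \<in> car V; v \<in> car V\<rbrakk> \<Longrightarrow>
      vscale V a (vadd V u v) = vadd V (vscale V a u) (vscale V a v)"
begin

lemma add_zero: "v \<in> car V \<Longrightarrow> vadd V v (vzero V) = v"
  using add_commute zero_add zero_in by metis

lemma add_left_commute:
  "\<lbrakk>u \<in> car V; v \<in> car V; w \<in> car V\<rbrakk> \<Longrightarrow> vadd V u (vadd V v w) = vadd V v (vadd V u w)"
  using add_assoc add_commute by metis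

lemma minus_in: "\<lbrakk>u \<in> car V; v \<in> car V\<rbrakk> \<Longrightarrow> vminus V u v \<in> car V"
  by (simp add: vminus_def add_in scale_in)

lemma minus_self: "v \<in> car V \<Longrightarrow> vminus V v v = vzero V"
  using scale_add_left[of v 1 "-1"] by (simp add: vminus_def scale_one scale_zero)

lemma scale_vzero: "vscale V c (vzero V) = vzero V"
  using scale_scale[of "vzero V" c 0] by (simp add: zero_in scale_zero)

lemma minus_zero: "v \<in> car V \<Longrightarrow> vminus V v (vzero V) = v"
  by (simp add: vminus_def scale_vzero add_zero)

lemma add_minus_cancel: "\<lbrakk>u \<in> car V; v \<in> car V\<rbrakk> \<Longrightarrow> vadd V v (vminus V u v) = u"
  using minus_self[of v]
  by (simp add: vminus_def add_left_commute[of v u] scale_in add_zero)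

lemma minus_add_cancel: "\<lbrakk>u \<in> car V; v \<in> car V\<rbrakk> \<Longrightarrow> vminus V (vadd V v u) v = u"
  using minus_self[of v]
  by (simp add: vminus_def add_commute[of v u] add_assoc scale_in add_zero)

lemma minus_chain:
  "\<lbrakk>u \<in> car V; v \<in> car V; w \<in> car V\<rbrakk> \<Longrightarrow> vadd V (vminus V u v) (vminus V v w) = vminus V u w"
  using add_minus_cancel[of "vscale V (-1) w" v]
  by (simp add: vminus_def add_assoc scale_in add_in add_commute[of "vscale V (-1) v"])

lemma scale_minus_swap: "\<lbrakk>u \<in> car V; v \<in> car V\<rbrakk> \<Longrightarrow> vscale V (-1) (vminus V u v) = vminus V v u"
  by (simp add: vminus_def scale_add_right scale_in scale_scale scale_one add_commute)

lemma scale_minus: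
  "\<lbrakk>u \<in> car V; v \<in> car V\<rbrakk> \<Longrightarrow> vscale V c (vminus V u v) = vminus V (vscale V c u) (vscale V c v)"
  by (simp add: vminus_def scale_add_right scale_in scale_scale mult.commute)

lemma minus_add_add:
  assumes "a \<in> car V" "b \<in> car V" "c \<in> car V" "d \<in> car V"
  shows "vminus V (vadd V a b) (vadd V c d) = vadd V (vminus V a c) (vminus V b d)"
  using assms by (simp add: vminus_def scale_add_right scale_in add_in add_assoc add_left_commute)

lemma car_subspace: "lin_subspace V (car V)"
  by (auto simp: lin_subspace_def zero_in add_in scale_in)

end

locale seminormed = vspace +
  assumes norm_ge_0: "v \<in> car V \<Longrightarrow> 0 \<le> vnorm V v"
    and norm_triangle: "\<lbrakk>u \<in> car V; v \<in> car V\<rbrakk> \<Longrightarrow> vnorm V (vadd V u v) \<le> vnorm V u + vnorm V v"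
    and norm_scale: "v \<in> car V \<Longrightarrow> vnorm V (vscale V c v) = cmod c * vnorm V v"
begin

lemma norm_zero: "vnorm V (vzero V) = 0"
  using norm_scale[of "vzero V" 0] by (simp add: zero_in scale_zero)

lemma norm_minus_commute: "\<lbrakk>u \<in> car V; v \<in> car V\<rbrakk> \<Longrightarrow> vnorm V (vminus V u v) = vnorm V (vminus V v u)"
  using norm_scale[of "vminus V u v" "-1"] by (simp add: scale_minus_swap minus_in)

lemma norm_minus_triangle:
  "\<lbrakk>u \<in> car V; v \<in> car V; w \<in> car V\<rbrakk> \<Longrightarrow>
    vnorm V (vminus V u w) \<le> vnorm V (vminus V u v) + vnorm V (vminus V v w)"
  using norm_triangle[of "vminus V u v" "vminus V v w"] by (simp add: minus_chain minus_in)

lemma norm_diff_le: "\<lbrakk>u \<in> car V; v \<in> car V\<rbrakk> \<Longrightarrow> \<bar>vnorm V u - vnorm V v\<bar> \<le> vnorm V (vminus V u v)"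
  using norm_minus_triangle[of u v "vzero V"] norm_minus_triangle[of v u "vzero V"]
    norm_minus_commute[of u v]
  by (simp add: zero_in minus_zero)

end

definition operator_bounded_by ::
    "real \<Rightarrow> ('v, 'm) nspace_scheme \<Rightarrow> ('w, 'n) nspace_scheme \<Rightarrow> ('v \<Rightarrow> 'w) \<Rightarrow> bool"
  where "operator_bounded_by K V W T \<longleftrightarrow> linear_operator V W T
    \<and> (\<forall>v\<in>car V. vnorm W (T v) \<le> K * vnorm V v)"

lemma linear_operatorD:
  assumes "linear_operator V W T"
  shows "v \<in> car V \<Longrightarrow> T v \<in> car W"
    and "\<lbrakk>u \<in> car V; v \<in> car V\<rbrakk> \<Longrightarrow> T (vadd V u v) = vadd W (T u) (T v)"
    and "v \<in> car V \<Longrightarrow> T (vscale V c v) = vscale W c (T v)"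
  using assms by (auto simp: linear_operator_def)

lemma linear_operator_minus:
  assumes "linear_operator V W T" "vspace V" "u \<in> car V" "v \<in> car V"
  shows "T (vminus V u v) = vminus W (T u) (T v)"
  using assms by (simp add: vminus_def linear_operatorD[OF assms(1)] vspace.scale_in)

lemma linear_operator_zero:
  assumes "linear_operator V W T" "vspace V" "vspace W"
  shows "T (vzero V) = vzero W"
  using linear_operatorD(1,3)[OF assms(1), of "vzero V"] assms(2,3)
  by (metis vspace.scale_zero vspace.zero_in)

lemma operator_bounded_byD:
  assumes "operator_bounded_by K V W T"
  shows "linear_operator V W T" "v \<in> car V \<Longrightarrow> vnorm W (T v) \<le> K * vnorm V v"
  using assms by (auto simp: operator_bounded_by_def)

lemma operator_bounded_by_compose:
  assumes "operator_bounded_by K U V S" "operator_bounded_by L V W T" "0 \<le> L"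
  shows "operator_bounded_by (L * K) U W (\<lambda>u. T (S u))"
proof -
  have "vnorm W (T (S u)) \<le> L * K * vnorm U u" if "u \<in> car U" for u
  proof -
    have "vnorm W (T (S u)) \<le> L * vnorm V (S u)"
      using assms that by (auto simp: operator_bounded_by_def linear_operator_def)
    also have "\<dots> \<le> L * (K * vnorm U u)"
      using assms that by (intro mult_left_mono) (auto simp: operator_bounded_by_def)
    finally show ?thesis by (simp add: mult.assoc)
  qed
  with assms show ?thesis by (auto simp: operator_bounded_by_def linear_operator_def Pi_iff)
qed

text \<open>Enlarging the constant is harmless because the norm of the domain is nonnegative; a
  nonnegative constant is needed as soon as one passes to infima over cosets.\<close>

lemma bounded_operator_nonneg_bound:
  assumes "bounded_operator V W T" "\<And>v. v \<in> car V \<Longrightarrow> 0 \<le> vnorm V v"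
  obtains K where "0 \<le> K" "operator_bounded_by K V W T"
proof -
  from assms(1) obtain K where K: "linear_operator V W T" "\<forall>v\<in>car V. vnorm W (T v) \<le> K * vnorm V v"
    by (auto simp: bounded_operator_def)
  have "vnorm W (T v) \<le> max K 0 * vnorm V v" if "v \<in> car V" for v
    using K(2) that assms(2)[OF that] by (meson max.cobounded1 mult_right_mono order_trans)
  with K(1) show thesis by (intro that[of "max K 0"]) (auto simp: operator_bounded_by_def)
qed

lemma operator_bounded_by_imp_bounded: "operator_bounded_by K V W T \<Longrightarrow> bounded_operator V W T"
  by (auto simp: operator_bounded_by_def bounded_operator_def)

lemma norm_closedD:
  "\<lbrakk>norm_closed V W; \<And>n. s n \<in> W; v \<in> car V; (\<lambda>n. vnorm V (vminus V (s n) v)) \<longlonglongrightarrow> 0\<rbrakk> \<Longrightarrow> v \<in> W"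
  unfolding norm_closed_def by blast

subsection \<open>Quotients\<close>

lemma quot_space_simps:
  "car (quot_space V N) = vcoset V N ` car V"
  "vzero (quot_space V N) = vcoset V N (vzero V)"
  "vnorm (quot_space V N) A = Inf (vnorm V ` A)"
  by (simp_all add: quot_space_def)

locale quotient = vspace +
  fixes N
  assumes subspace: "lin_subspace V N"
begin

lemma subspace_in: "n \<in> N \<Longrightarrow> n \<in> car V"
  and subspace_zero: "vzero V \<in> N"
  and subspace_add: "\<lbrakk>m \<in> N; n \<in> N\<rbrakk> \<Longrightarrow> vadd V m n \<in> N"
  and subspace_scale: "n \<in> N \<Longrightarrow> vscale V c n \<in> N"
  using subspace by (auto simp: lin_subspace_def)

lemma coset_mem_iff:
  assumes "v \<in> car V"
  shows "u \<in> vcoset V N v \<longleftrightarrow> u \<in> car V \<and> vminus V u v \<in> N"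
proof
  assume "u \<in> vcoset V N v"
  then obtain n where "n \<in> N" "u = vadd V v n" by (auto simp: vcoset_def)
  with assms show "u \<in> car V \<and> vminus V u v \<in> N"
    by (simp add: subspace_in add_in minus_add_cancel)
next
  assume "u \<in> car V \<and> vminus V u v \<in> N"
  then have "u = vadd V v (vminus V u v)" "vminus V u v \<in> N"
    using assms by (auto simp: add_minus_cancel)
  then show "u \<in> vcoset V N v" by (auto simp: vcoset_def)
qed

lemma coset_self: "v \<in> car V \<Longrightarrow> v \<in> vcoset V N v"
  by (simp add: coset_mem_iff minus_self subspace_zero)

lemma coset_nonempty: "v \<in> car V \<Longrightarrow> vcoset V N v \<noteq> {}"
  using coset_self by auto

lemma coset_eqI:
  assumes "u \<in> car V" "v \<in> car V" "vminus V u v \<in> N"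
  shows "vcoset V N u = vcoset V N v"
proof -
  have "vminus V v u \<in> N"
    using assms subspace_scale[of "vminus V u v" "-1"] by (simp add: scale_minus_swap)
  then have "vminus V w u \<in> N \<longleftrightarrow> vminus V w v \<in> N" if "w \<in> car V" for w
    using assms that minus_chain[of w u v] minus_chain[of w v u]
      subspace_add[of "vminus V w u" "vminus V u v"] subspace_add[of "vminus V w v" "vminus V v u"]
    by auto
  then show ?thesis using assms by (auto simp: coset_mem_iff)
qed

lemma coset_eq_iff:
  assumes "u \<in> car V" "v \<in> car V"
  shows "vcoset V N u = vcoset V N v \<longleftrightarrow> vminus V u v \<in> N"
proof
  assume "vcoset V N u = vcoset V N v"
  with coset_self[OF assms(1)] have "u \<in> vcoset V N v" by simp
  with assms(2) show "vminus V u v \<in> N" by (simp add: coset_mem_iff)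
qed (rule coset_eqI[OF assms])

lemma coset_of_mem: "\<lbrakk>v \<in> car V; u \<in> vcoset V N v\<rbrakk> \<Longrightarrow> vcoset V N u = vcoset V N v"
  by (simp add: coset_mem_iff coset_eqI)

lemma quot_carE:
  assumes "A \<in> car (quot_space V N)"
  obtains v where "v \<in> car V" "A = vcoset V N v"
  using assms by (auto simp: quot_space_simps)

lemma coset_in: "v \<in> car V \<Longrightarrow> vcoset V N v \<in> car (quot_space V N)"
  by (simp add: quot_space_simps)

lemma quot_add:
  assumes "u \<in> car V" "v \<in> car V"
  shows "vadd (quot_space V N) (vcoset V N u) (vcoset V N v) = vcoset V N (vadd V u v)"
proof -
  have "vcoset V N (vadd V a b) = vcoset V N (vadd V u v)"
    if "a \<in> vcoset V N u" "b \<in> vcoset V N v" for a b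
    using that assms by (intro coset_eqI) (auto simp: coset_mem_iff add_in minus_add_add subspace_add)
  then have "vadd (quot_space V N) (vcoset V N u) (vcoset V N v)
      = (\<Union>a\<in>vcoset V N u. \<Union>b\<in>vcoset V N v. vcoset V N (vadd V u v))"
    unfolding quot_space_def by (simp cong: SUP_cong)
  with assms show ?thesis by (simp add: coset_nonempty)
qed

lemma quot_scale:
  assumes "v \<in> car V"
  shows "vscale (quot_space V N) c (vcoset V N v) = vcoset V N (vscale V c v)"
proof -
  have "vcoset V N (vscale V c a) = vcoset V N (vscale V c v)" if "a \<in> vcoset V N v" for a
    using that assms
    by (intro coset_eqI) (auto simp: coset_mem_iff scale_in scale_minus[symmetric] subspace_scale)
  then have "vscale (quot_space V N) c (vcoset V N v) = (\<Union>a\<in>vcoset V N v. vcoset V N (vscale V c v))"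
    unfolding quot_space_def by (simp cong: SUP_cong)
  with assms show ?thesis by (simp add: coset_nonempty)
qed

lemma quot_minus:
  assumes "u \<in> car V" "v \<in> car V"
  shows "vminus (quot_space V N) (vcoset V N u) (vcoset V N v) = vcoset V N (vminus V u v)"
  using assms by (simp add: vminus_def quot_add quot_scale scale_in)

lemma vspace_quot: "vspace (quot_space V N)"
proof unfold_locales
  show "vzero (quot_space V N) \<in> car (quot_space V N)"
    by (simp add: quot_space_simps zero_in)
qed (auto elim!: quot_carE simp: quot_add quot_scale coset_in add_in scale_in zero_in quot_space_simps(2)
    add_assoc add_commute add_left_commute zero_add add_zero scale_zero scale_one scale_scale scale_add_left scale_add_right)

lemma quot_norm_le:
  assumes "\<And>u. u \<in> car V \<Longrightarrow> 0 \<le> vnorm V u" "v \<in> car V" "u \<in> vcoset V N v"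
  shows "vnorm (quot_space V N) (vcoset V N v) \<le> vnorm V u"
  unfolding quot_space_simps
  using assms by (intro cInf_lower bdd_belowI[of _ 0]) (auto simp: coset_mem_iff)

lemma quot_norm_greatest:
  assumes "v \<in> car V" "\<And>u. u \<in> vcoset V N v \<Longrightarrow> c \<le> vnorm V u"
  shows "c \<le> vnorm (quot_space V N) (vcoset V N v)"
  unfolding quot_space_simps using assms coset_self by (intro cInf_greatest) auto

lemma quot_norm_approx:
  assumes "v \<in> car V" "0 < e"
  obtains u where "u \<in> vcoset V N v" "vnorm V u < vnorm (quot_space V N) (vcoset V N v) + e"
proof (rule ccontr)
  assume "\<not> thesis"
  then have "vnorm (quot_space V N) (vcoset V N v) + e \<le> vnorm (quot_space V N) (vcoset V N v)"
    using that by (intro quot_norm_greatest[OF assms(1)]) (auto simp: not_less[symmetric])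
  with assms(2) show False by simp
qed

end

text \<open>The operator that T induces on quotients. The union over representatives collapses to a single
  coset when T maps the one subspace into the other.\<close>

definition quot_map :: "('w, 'n) nspace_scheme \<Rightarrow> 'w set \<Rightarrow> ('v \<Rightarrow> 'w) \<Rightarrow> 'v set \<Rightarrow> 'w set"
  where "quot_map W M T A = (\<Union>a\<in>A. vcoset W M (T a))"

locale quotient_map = source: quotient V N + target: quotient W M
  for V :: "('v, 'm) nspace_scheme" and N and W :: "('w, 'n) nspace_scheme" and M +
  fixes T
  assumes linear: "linear_operator V W T"
    and maps_subspace: "\<And>n. n \<in> N \<Longrightarrow> T n \<in> M"
begin

lemma quot_map_coset:
  assumes "v \<in> car V"
  shows "quot_map W M T (vcoset V N v) = vcoset W M (T v)"
proof -
  have "vcoset W M (T a) = vcoset W M (T v)" if "a \<in> vcoset V N v" for a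
    using that assms
    by (intro target.coset_eqI)
      (auto simp: source.coset_mem_iff linear_operatorD[OF linear] maps_subspace
        linear_operator_minus[OF linear source.vspace_axioms, symmetric])
  then have "quot_map W M T (vcoset V N v) = (\<Union>a\<in>vcoset V N v. vcoset W M (T v))"
    unfolding quot_map_def by (simp cong: SUP_cong)
  with assms show ?thesis by (simp add: source.coset_nonempty)
qed

lemma linear_quot_map: "linear_operator (quot_space V N) (quot_space W M) (quot_map W M T)"
  by (auto simp: linear_operator_def quot_map_coset source.quot_add target.quot_add source.quot_scale
      target.quot_scale source.add_in source.scale_in linear_operatorD[OF linear]
      target.coset_in elim!: source.quot_carE)

lemma quot_map_bounded_by:
  assumes "operator_bounded_by K V W T" "0 \<le> K" "\<And>w. w \<in> car W \<Longrightarrow> 0 \<le> vnorm W w"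
  shows "operator_bounded_by K (quot_space V N) (quot_space W M) (quot_map W M T)"
proof -
  have "vnorm (quot_space W M) (vcoset W M (T v)) \<le> K * vnorm (quot_space V N) (vcoset V N v)"
    if v: "v \<in> car V" for v
  proof (rule field_le_epsilon)
    fix e :: real assume "0 < e"
    then have "0 < e / (K + 1)" using assms(2) by simp
    then obtain u where u: "u \<in> vcoset V N v"
      "vnorm V u < vnorm (quot_space V N) (vcoset V N v) + e / (K + 1)"
      using source.quot_norm_approx[OF v] by metis
    have uV: "u \<in> car V" and eq: "vcoset V N u = vcoset V N v"
      using u(1) v by (auto simp: source.coset_mem_iff source.coset_of_mem)
    have "vcoset W M (T v) = vcoset W M (T u)"
      using quot_map_coset[OF v] quot_map_coset[OF uV] eq by simp
    then have "vnorm (quot_space W M) (vcoset W M (T v)) \<le> vnorm W (T u)"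
      using target.quot_norm_le[OF assms(3), of "T u" "T u"] uV
      by (simp add: target.coset_self linear_operatorD[OF linear])
    also have "\<dots> \<le> K * vnorm V u" using assms(1) uV by (simp add: operator_bounded_by_def)
    also have "\<dots> \<le> K * (vnorm (quot_space V N) (vcoset V N v) + e / (K + 1))"
      using u(2) assms(2) by (intro mult_left_mono) auto
    also have "\<dots> \<le> K * vnorm (quot_space V N) (vcoset V N v) + e"
      using assms(2) \<open>0 < e\<close> by (simp add: field_simps)
    finally show "vnorm (quot_space W M) (vcoset W M (T v))
      \<le> K * vnorm (quot_space V N) (vcoset V N v) + e" .
  qed
  then show ?thesis
    by (auto simp: operator_bounded_by_def linear_quot_map quot_map_coset elim!: source.quot_carE)
qed

end

locale seminormed_quotient = seminormed + quotient
begin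

lemma coset_map_bounded_by: "operator_bounded_by 1 V (quot_space V N) (vcoset V N)"
  by (auto simp: operator_bounded_by_def linear_operator_def coset_in quot_add quot_scale
      intro: quot_norm_le[OF norm_ge_0] coset_self)

lemma quot_norm_ge_0: "v \<in> car V \<Longrightarrow> 0 \<le> vnorm (quot_space V N) (vcoset V N v)"
  by (auto intro!: quot_norm_greatest norm_ge_0 simp: coset_mem_iff)

lemma quot_norm_scale_le:
  assumes "v \<in> car V"
  shows "vnorm (quot_space V N) (vcoset V N (vscale V c v)) \<le> cmod c * vnorm (quot_space V N) (vcoset V N v)"
proof -
  interpret scaling: quotient_map V N V N "vscale V c"
    by unfold_locales (auto simp: linear_operator_def scale_in scale_add_right scale_scale
        mult.commute subspace_scale)
  have "operator_bounded_by (cmod c) (quot_space V N) (quot_space V N) (quot_map V N (vscale V c))"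
    by (rule scaling.quot_map_bounded_by)
      (auto simp: operator_bounded_by_def scaling.linear norm_scale norm_ge_0)
  from operator_bounded_byD(2)[OF this coset_in[OF assms]] show ?thesis
    using assms by (simp add: scaling.quot_map_coset)
qed

lemma seminormed_quot: "seminormed (quot_space V N)"
proof -
  interpret Q: vspace "quot_space V N" by (rule vspace_quot)
  show ?thesis
  proof unfold_locales
    fix A assume "A \<in> car (quot_space V N)"
    then show "0 \<le> vnorm (quot_space V N) A" by (auto elim!: quot_carE intro: quot_norm_ge_0)
  next
    fix A B assume "A \<in> car (quot_space V N)" "B \<in> car (quot_space V N)"
    then obtain u v where uv: "u \<in> car V" "A = vcoset V N u" "v \<in> car V" "B = vcoset V N v"
      by (metis quot_carE)
    show "vnorm (quot_space V N) (vadd (quot_space V N) A B)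
      \<le> vnorm (quot_space V N) A + vnorm (quot_space V N) B"
    proof (rule field_le_epsilon)
      fix e :: real assume "0 < e"
      obtain a where a: "a \<in> vcoset V N u" "vnorm V a < vnorm (quot_space V N) A + e / 2"
        using quot_norm_approx[OF uv(1), of "e / 2"] \<open>0 < e\<close> uv by auto
      obtain b where b: "b \<in> vcoset V N v" "vnorm V b < vnorm (quot_space V N) B + e / 2"
        using quot_norm_approx[OF uv(3), of "e / 2"] \<open>0 < e\<close> uv by auto
      have "vadd V a b \<in> vcoset V N (vadd V u v)"
        using a b uv by (auto simp: coset_mem_iff add_in minus_add_add subspace_add)
      then have "vnorm (quot_space V N) (vadd (quot_space V N) A B) \<le> vnorm V (vadd V a b)"
        using uv by (simp add: quot_add quot_norm_le norm_ge_0 add_in)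
      also have "\<dots> \<le> vnorm V a + vnorm V b"
        using a b uv by (intro norm_triangle) (auto simp: coset_mem_iff)
      finally show "vnorm (quot_space V N) (vadd (quot_space V N) A B)
        \<le> vnorm (quot_space V N) A + vnorm (quot_space V N) B + e"
        using a b by simp
    qed
  next
    fix A c assume "A \<in> car (quot_space V N)"
    then obtain v where v: "v \<in> car V" "A = vcoset V N v" by (rule quot_carE)
    have le: "vnorm (quot_space V N) (vcoset V N (vscale V c v)) \<le> cmod c * vnorm (quot_space V N) (vcoset V N v)"
      by (rule quot_norm_scale_le[OF v(1)])
    \<comment> \<open>The reverse estimate is the same one for the inverse scalar.\<close>
    have "cmod c * vnorm (quot_space V N) (vcoset V N v) \<le> vnorm (quot_space V N) (vcoset V N (vscale V c v))"
    proof (cases "c = 0")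
      case True
      then show ?thesis using v by (simp add: quot_norm_ge_0 scale_in)
    next
      case False
      then show ?thesis
        using quot_norm_scale_le[of "vscale V c v" "inverse c"] v
        by (simp add: scale_in scale_scale scale_one norm_divide field_simps)
    qed
    with le v show "vnorm (quot_space V N) (vscale (quot_space V N) c A) = cmod c * vnorm (quot_space V N) A"
      by (simp add: quot_scale)
  qed
qed

text \<open>If the norms of elements u(n) of the coset of v tend to zero, then the differences v - u(n) lie in
  the subspace and converge to v.\<close>

lemma quot_norm_zero_imp:
  assumes "norm_closed V N" "v \<in> car V" "vnorm (quot_space V N) (vcoset V N v) = 0"
  shows "vcoset V N v = vzero (quot_space V N)"
proof -
  have "\<exists>u. u \<in> vcoset V N v \<and> vnorm V u < 1 / real (Suc n)" for n
    using quot_norm_approx[OF assms(2), of "1 / real (Suc n)"] assms(3) by auto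
  then obtain s where s: "\<And>n. s n \<in> vcoset V N v" "\<And>n. vnorm V (s n) < 1 / real (Suc n)"
    by metis
  have sV: "s n \<in> car V" "vminus V (s n) v \<in> N" for n using s(1)[of n] assms(2)
    by (auto simp: coset_mem_iff)
  have "vminus V v (s n) \<in> N" for n
    using subspace_scale[OF sV(2), of "-1"] sV(1) assms(2) by (simp add: scale_minus_swap)
  moreover have "vnorm V (vminus V (vminus V v (s n)) v) = vnorm V (s n)" for n
  proof -
    have "vminus V (vminus V v (s n)) v = vscale V (-1) (s n)"
      using minus_add_cancel[of "vscale V (-1) (s n)" v] sV assms(2) by (simp add: vminus_def scale_in)
    then show ?thesis using sV by (simp add: norm_scale)
  qed
  moreover have "(\<lambda>n. vnorm V (s n)) \<longlonglongrightarrow> 0"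
  proof (rule tendsto_sandwich[of "\<lambda>_. 0"])
    show "\<forall>\<^sub>F n in sequentially. 0 \<le> vnorm V (s n)" by (simp add: sV norm_ge_0)
    show "\<forall>\<^sub>F n in sequentially. vnorm V (s n) \<le> 1 / real (Suc n)" using s(2) by (simp add: less_imp_le)
    show "(\<lambda>n. 1 / real (Suc n)) \<longlonglongrightarrow> 0" using LIMSEQ_inverse_real_of_nat by (simp add: inverse_eq_divide)
  qed simp
  ultimately have "v \<in> N"
    using norm_closedD[OF assms(1), of "\<lambda>n. vminus V v (s n)" v] assms(2) by simp
  then show ?thesis
    unfolding quot_space_simps using assms(2) by (intro coset_eqI) (simp_all add: zero_in minus_zero)
qed

end

subsection \<open>Spans\<close>

lemma lin_span_subspace:
  assumes "vspace V" "S \<subseteq> car V"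
  shows "lin_subspace V (lin_span V S)"
proof -
  have "car V \<in> {W. lin_subspace V W \<and> S \<subseteq> W}"
    using vspace.car_subspace[OF assms(1)] assms(2) by simp
  then show ?thesis unfolding lin_span_def hull_def lin_subspace_def by blast
qed

lemma closed_lin_span_subspace:
  assumes "vspace V" "S \<subseteq> car V"
  shows "lin_subspace V (closed_lin_span V S)" "norm_closed V (closed_lin_span V S)"
proof -
  have *: "car V \<in> {W. (lin_subspace V W \<and> norm_closed V W) \<and> S \<subseteq> W}"
    using vspace.car_subspace[OF assms(1)] assms(2) by (simp add: norm_closed_def)
  show "lin_subspace V (closed_lin_span V S)"
    using * unfolding closed_lin_span_def hull_def lin_subspace_def by blast
  show "norm_closed V (closed_lin_span V S)"
    unfolding norm_closed_def
  proof (intro allI impI)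
    fix s v assume s: "(\<forall>n. s n \<in> closed_lin_span V S) \<and> v \<in> car V
      \<and> (\<lambda>n. vnorm V (vminus V (s n) v)) \<longlonglongrightarrow> 0"
    have "v \<in> W" if "lin_subspace V W" "norm_closed V W" "S \<subseteq> W" for W
    proof -
      have "\<forall>n. s n \<in> W" using s that by (auto simp: closed_lin_span_def hull_def)
      with s norm_closedD[OF that(2), of s v] show ?thesis by simp
    qed
    then show "v \<in> closed_lin_span V S" by (auto simp: closed_lin_span_def hull_def)
  qed
qed

lemma subspace_vimage:
  assumes "vspace V" "vspace W" "linear_operator V W T" "lin_subspace W M"
  shows "lin_subspace V {v \<in> car V. T v \<in> M}"
  using assms linear_operator_zero[OF assms(3,1,2)]
  by (auto simp: lin_subspace_def linear_operator_def vspace.zero_in vspace.add_in vspace.scale_in)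

lemma lin_span_image:
  assumes "vspace V" "vspace W" "linear_operator V W T" "S \<subseteq> car V" "R \<subseteq> car W"
    and "\<And>s. s \<in> S \<Longrightarrow> T s \<in> R" and v: "v \<in> lin_span V S"
  shows "T v \<in> lin_span W R"
proof -
  have "lin_subspace V {v \<in> car V. T v \<in> lin_span W R}"
    by (rule subspace_vimage[OF assms(1-3) lin_span_subspace[OF assms(2,5)]])
  moreover have "S \<subseteq> {v \<in> car V. T v \<in> lin_span W R}"
    using assms(4,6) hull_subset[of R] by (auto simp: lin_span_def)
  ultimately have "lin_span V S \<subseteq> {v \<in> car V. T v \<in> lin_span W R}"
    unfolding lin_span_def[of V] by (intro hull_minimal)
  with v show ?thesis by auto
qed

lemma closed_lin_span_image:
  assumes "seminormed V" "seminormed W" "operator_bounded_by K V W T" "S \<subseteq> car V" "R \<subseteq> car W"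
    and "\<And>s. s \<in> S \<Longrightarrow> T s \<in> R" and v: "v \<in> closed_lin_span V S"
  shows "T v \<in> closed_lin_span W R"
proof -
  interpret V: seminormed V by fact
  interpret W: seminormed W by fact
  note lin = operator_bounded_byD(1)[OF assms(3)]
  note span = closed_lin_span_subspace[OF W.vspace_axioms assms(5)]
  let ?U = "{v \<in> car V. T v \<in> closed_lin_span W R}"
  have "norm_closed V ?U"
    unfolding norm_closed_def
  proof (intro allI impI)
    fix s v assume s: "(\<forall>n. s n \<in> ?U) \<and> v \<in> car V \<and> (\<lambda>n. vnorm V (vminus V (s n) v)) \<longlonglongrightarrow> 0"
    have "(\<lambda>n. vnorm W (vminus W (T (s n)) (T v))) \<longlonglongrightarrow> 0"
    proof (rule tendsto_sandwich[of "\<lambda>_. 0" _ _ "\<lambda>n. K * vnorm V (vminus V (s n) v)"])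
      show "\<forall>\<^sub>F n in sequentially. 0 \<le> vnorm W (vminus W (T (s n)) (T v))"
        using s by (intro always_eventually allI W.norm_ge_0 W.minus_in linear_operatorD[OF lin]) auto
      have "vnorm W (vminus W (T (s n)) (T v)) \<le> K * vnorm V (vminus V (s n) v)" for n
        using s operator_bounded_byD(2)[OF assms(3), of "vminus V (s n) v"]
        by (simp add: V.minus_in linear_operator_minus[OF lin V.vspace_axioms])
      then show "\<forall>\<^sub>F n in sequentially. vnorm W (vminus W (T (s n)) (T v)) \<le> K * vnorm V (vminus V (s n) v)"
        by simp
      show "(\<lambda>n. K * vnorm V (vminus V (s n) v)) \<longlonglongrightarrow> 0" using s tendsto_mult_right_zero by blast
    qed simp
    moreover have "T v \<in> car W" "\<forall>n. T (s n) \<in> closed_lin_span W R"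
      using s linear_operatorD[OF lin] by auto
    ultimately have "T v \<in> closed_lin_span W R"
      using norm_closedD[OF span(2), of "\<lambda>n. T (s n)" "T v"] by simp
    with s show "v \<in> ?U" by blast
  qed
  moreover have "lin_subspace V ?U"
    by (rule subspace_vimage[OF V.vspace_axioms W.vspace_axioms lin span(1)])
  moreover have "S \<subseteq> ?U"
    using assms(4,6) hull_subset[of R] by (auto simp: closed_lin_span_def)
  ultimately have "closed_lin_span V S \<subseteq> ?U"
    unfolding closed_lin_span_def[of V] by (intro hull_minimal) auto
  with v show ?thesis by auto
qed

subsection \<open>Completions\<close>

context seminormed
begin

lemma cauchy_car_iff:
  "s \<in> car (cauchy_space V) \<longleftrightarrow> (\<forall>n. s n \<in> car V)
    \<and> (\<forall>e>0. \<exists>n0. \<forall>m\<ge>n0. \<forall>n\<ge>n0. vnorm V (vminus V (s m) (s n)) < e)"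
  by (simp add: cauchy_space_def)

lemma cauchy_norm_tendsto:
  assumes "s \<in> car (cauchy_space V)"
  shows "(\<lambda>n. vnorm V (s n)) \<longlonglongrightarrow> vnorm (cauchy_space V) s"
proof -
  have "Cauchy (\<lambda>n. vnorm V (s n))"
    unfolding Cauchy_def dist_real_def
    using assms norm_diff_le unfolding cauchy_car_iff by (meson order_le_less_trans)
  then show ?thesis
    by (simp add: cauchy_space_def convergent_LIMSEQ_iff[symmetric] real_Cauchy_convergent)
qed

lemma cauchy_add_in:
  assumes "s \<in> car (cauchy_space V)" "t \<in> car (cauchy_space V)"
  shows "(\<lambda>n. vadd V (s n) (t n)) \<in> car (cauchy_space V)"
  unfolding cauchy_car_iff
proof (intro conjI allI impI)
  have st: "s n \<in> car V" "t n \<in> car V" for n using assms by (auto simp: cauchy_car_iff)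
  show "vadd V (s n) (t n) \<in> car V" for n by (simp add: st add_in)
  fix e :: real assume "0 < e"
  obtain n1 where n1: "\<And>m n. m \<ge> n1 \<Longrightarrow> n \<ge> n1 \<Longrightarrow> vnorm V (vminus V (s m) (s n)) < e / 2"
    using assms(1) \<open>0 < e\<close> unfolding cauchy_car_iff by (meson half_gt_zero)
  obtain n2 where n2: "\<And>m n. m \<ge> n2 \<Longrightarrow> n \<ge> n2 \<Longrightarrow> vnorm V (vminus V (t m) (t n)) < e / 2"
    using assms(2) \<open>0 < e\<close> unfolding cauchy_car_iff by (meson half_gt_zero)
  have "vnorm V (vminus V (vadd V (s m) (t m)) (vadd V (s n) (t n))) < e"
    if "m \<ge> max n1 n2" "n \<ge> max n1 n2" for m n
    using n1[of m n] n2[of m n] that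
      norm_triangle[of "vminus V (s m) (s n)" "vminus V (t m) (t n)"]
    by (simp add: minus_add_add st minus_in)
  then show "\<exists>n0. \<forall>m\<ge>n0. \<forall>n\<ge>n0. vnorm V (vminus V (vadd V (s m) (t m)) (vadd V (s n) (t n))) < e"
    by blast
qed

end

lemma bounded_image_Cauchy:
  assumes "seminormed V" "seminormed W" "operator_bounded_by K V W T" "0 \<le> K" "s \<in> car (cauchy_space V)"
  shows "(\<lambda>n. T (s n)) \<in> car (cauchy_space W)"
proof -
  interpret V: seminormed V by fact
  interpret W: seminormed W by fact
  note lin = operator_bounded_byD(1)[OF assms(3)]
  have s: "s n \<in> car V" for n using assms(5) by (auto simp: V.cauchy_car_iff)
  show ?thesis
    unfolding W.cauchy_car_iff
  proof (intro conjI allI impI)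
    show "T (s n) \<in> car W" for n by (simp add: s linear_operatorD[OF lin])
    fix e :: real assume "0 < e"
    then have "0 < e / (K + 1)" using assms(4) by simp
    then obtain n0 where n0: "\<And>m n. m \<ge> n0 \<Longrightarrow> n \<ge> n0 \<Longrightarrow> vnorm V (vminus V (s m) (s n)) < e / (K + 1)"
      using assms(5) unfolding V.cauchy_car_iff by metis
    have "vnorm W (vminus W (T (s m)) (T (s n))) < e" if "m \<ge> n0" "n \<ge> n0" for m n
    proof -
      have "vnorm W (vminus W (T (s m)) (T (s n))) \<le> K * vnorm V (vminus V (s m) (s n))"
        using operator_bounded_byD(2)[OF assms(3), of "vminus V (s m) (s n)"]
        by (simp add: s V.minus_in linear_operator_minus[OF lin V.vspace_axioms])
      also have "\<dots> \<le> K * (e / (K + 1))"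
        using n0[OF that] assms(4) by (intro mult_left_mono) auto
      also have "\<dots> < e" using assms(4) \<open>0 < e\<close> by (simp add: field_simps)
      finally show ?thesis .
    qed
    then show "\<exists>n0. \<forall>m\<ge>n0. \<forall>n\<ge>n0. vnorm W (vminus W (T (s m)) (T (s n))) < e" by blast
  qed
qed

context seminormed
begin

lemma cauchy_scale_in:
  assumes "s \<in> car (cauchy_space V)"
  shows "(\<lambda>n. vscale V c (s n)) \<in> car (cauchy_space V)"
proof (rule bounded_image_Cauchy[OF seminormed_axioms seminormed_axioms, where K = "cmod c" and T = "vscale V c"])
  show "operator_bounded_by (cmod c) V V (vscale V c)"
    by (auto simp: operator_bounded_by_def linear_operator_def scale_in scale_add_right scale_scale
        mult.commute norm_scale)
qed (use assms in auto)

lemma cauchy_const: "v \<in> car V \<Longrightarrow> (\<lambda>_. v) \<in> car (cauchy_space V)"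
  by (auto simp: cauchy_car_iff minus_self norm_zero)

lemma cauchy_simps:
  "vzero (cauchy_space V) = (\<lambda>_. vzero V)"
  "vadd (cauchy_space V) s t = (\<lambda>n. vadd V (s n) (t n))"
  "vscale (cauchy_space V) c s = (\<lambda>n. vscale V c (s n))"
  by (simp_all add: cauchy_space_def)

lemma cauchy_minus: "vminus (cauchy_space V) s t = (\<lambda>n. vminus V (s n) (t n))"
  by (simp add: vminus_def cauchy_simps)

lemma cauchyD: "s \<in> car (cauchy_space V) \<Longrightarrow> s n \<in> car V"
  by (simp add: cauchy_car_iff)

lemma seminormed_cauchy: "seminormed (cauchy_space V)"
proof unfold_locales
  fix s t c
  assume s: "s \<in> car (cauchy_space V)" and t: "t \<in> car (cauchy_space V)"
  show "vnorm (cauchy_space V) (vadd (cauchy_space V) s t)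
    \<le> vnorm (cauchy_space V) s + vnorm (cauchy_space V) t"
  proof (rule tendsto_le)
    show "(\<lambda>n. vnorm V (s n) + vnorm V (t n)) \<longlonglongrightarrow> vnorm (cauchy_space V) s + vnorm (cauchy_space V) t"
      by (intro tendsto_add cauchy_norm_tendsto s t)
    show "(\<lambda>n. vnorm V (vadd V (s n) (t n))) \<longlonglongrightarrow> vnorm (cauchy_space V) (vadd (cauchy_space V) s t)"
      using cauchy_norm_tendsto[OF cauchy_add_in[OF s t]] by (simp add: cauchy_simps)
  qed (use s t in \<open>auto simp: norm_triangle cauchyD\<close>)
next
  fix s c assume s: "s \<in> car (cauchy_space V)"
  show "0 \<le> vnorm (cauchy_space V) s"
    using s by (intro tendsto_lowerbound[OF cauchy_norm_tendsto[OF s]] always_eventually allI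
        norm_ge_0 cauchyD) auto
  show "vnorm (cauchy_space V) (vscale (cauchy_space V) c s) = cmod c * vnorm (cauchy_space V) s"
  proof (rule LIMSEQ_unique)
    show "(\<lambda>n. vnorm V (vscale V c (s n))) \<longlonglongrightarrow> vnorm (cauchy_space V) (vscale (cauchy_space V) c s)"
      using cauchy_norm_tendsto[OF cauchy_scale_in[OF s]] by (simp add: cauchy_simps)
    show "(\<lambda>n. vnorm V (vscale V c (s n))) \<longlonglongrightarrow> cmod c * vnorm (cauchy_space V) s"
      using s by (simp add: norm_scale cauchyD tendsto_mult_left cauchy_norm_tendsto)
  qed
qed (auto simp: cauchy_simps cauchy_add_in cauchy_scale_in cauchy_const zero_in cauchyD
    add_assoc add_commute add_left_commute zero_add add_zero scale_zero scale_one scale_scale scale_add_left scale_add_right)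

lemma null_seqs_iff: "s \<in> null_seqs V \<longleftrightarrow> s \<in> car (cauchy_space V) \<and> vnorm (cauchy_space V) s = 0"
  using cauchy_norm_tendsto[of s] LIMSEQ_unique by (auto simp: null_seqs_def)

lemma completion_quotient: "seminormed_quotient (cauchy_space V) (null_seqs V)"
proof -
  interpret C: seminormed "cauchy_space V" by (rule seminormed_cauchy)
  show ?thesis
  proof unfold_locales
    have "vnorm (cauchy_space V) (vadd (cauchy_space V) s t) = 0"
      if "s \<in> null_seqs V" "t \<in> null_seqs V" for s t
      using that C.norm_triangle[of s t] C.norm_ge_0[OF C.add_in[of s t]] by (simp add: null_seqs_iff)
    then show "lin_subspace (cauchy_space V) (null_seqs V)"
      by (auto simp: lin_subspace_def null_seqs_iff C.norm_zero C.zero_in C.add_in C.scale_in C.norm_scale)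
  qed
qed

lemma seminormed_completion: "seminormed (completion V)"
  unfolding completion_def by (rule seminormed_quotient.seminormed_quot[OF completion_quotient])

lemma to_completion_linear: "linear_operator V (completion V) (to_completion V)"
proof -
  interpret C: seminormed_quotient "cauchy_space V" "null_seqs V" by (rule completion_quotient)
  show ?thesis
    unfolding linear_operator_def completion_def to_completion_def
    by (auto simp: C.coset_in C.quot_add C.quot_scale cauchy_const add_in scale_in)
      (simp_all add: cauchy_simps)
qed

text \<open>A class is the limit of the terms of any Cauchy sequence that represents it.\<close>

lemma completion_approx:
  assumes "z \<in> car (completion V)" "0 < e"
  obtains v where "v \<in> car V" "vnorm (completion V) (vminus (completion V) z (to_completion V v)) < e"
proof -
  interpret C: seminormed_quotient "cauchy_space V" "null_seqs V" by (rule completion_quotient)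
  obtain s where s: "s \<in> car (cauchy_space V)" "z = vcoset (cauchy_space V) (null_seqs V) s"
    using assms(1) unfolding completion_def by (rule C.quot_carE)
  obtain n0 where n0: "\<And>m n. m \<ge> n0 \<Longrightarrow> n \<ge> n0 \<Longrightarrow> vnorm V (vminus V (s m) (s n)) < e / 2"
    using s(1) assms(2) unfolding cauchy_car_iff by (meson half_gt_zero)
  let ?c = "\<lambda>_. s n0"
  have c: "s n0 \<in> car V" "?c \<in> car (cauchy_space V)" using s by (auto simp: cauchyD intro: cauchy_const)
  let ?d = "vminus (cauchy_space V) s ?c"
  have d: "?d \<in> car (cauchy_space V)" by (simp add: C.minus_in s c)
  have "vnorm (completion V) (vminus (completion V) z (to_completion V (s n0)))
      = vnorm (completion V) (vcoset (cauchy_space V) (null_seqs V) ?d)"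
    using s c by (simp add: completion_def to_completion_def C.quot_minus)
  also have "\<dots> \<le> vnorm (cauchy_space V) ?d"
    unfolding completion_def using d by (intro C.quot_norm_le C.norm_ge_0 C.coset_self)
  also have "\<dots> \<le> e / 2"
  proof (rule tendsto_upperbound[OF cauchy_norm_tendsto[OF d]])
    show "\<forall>\<^sub>F n in sequentially. vnorm V (?d n) \<le> e / 2"
      using n0 by (auto simp: cauchy_minus eventually_sequentially less_imp_le intro!: exI[of _ n0])
  qed simp
  also have "\<dots> < e" using assms(2) by simp
  finally show thesis using that c by blast
qed

end

definition completion_map ::
    "('w, 'n) nspace_scheme \<Rightarrow> ('v \<Rightarrow> 'w) \<Rightarrow> (nat \<Rightarrow> 'v) set \<Rightarrow> (nat \<Rightarrow> 'w) set"
  where "completion_map W T = quot_map (cauchy_space W) (null_seqs W) (\<lambda>s n. T (s n))"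

lemma completion_map:
  assumes "seminormed V" "seminormed W" "operator_bounded_by K V W T" "0 \<le> K"
  shows "operator_bounded_by K (completion V) (completion W) (completion_map W T)"
    and "v \<in> car V \<Longrightarrow> completion_map W T (to_completion V v) = to_completion W (T v)"
proof -
  interpret V: seminormed V by fact
  interpret W: seminormed W by fact
  interpret CV: seminormed_quotient "cauchy_space V" "null_seqs V" by (rule V.completion_quotient)
  interpret CW: seminormed_quotient "cauchy_space W" "null_seqs W" by (rule W.completion_quotient)
  note lin = operator_bounded_byD(1)[OF assms(3)]
  have bnd: "operator_bounded_by K (cauchy_space V) (cauchy_space W) (\<lambda>s n. T (s n))"
    unfolding operator_bounded_by_def linear_operator_def
  proof (intro conjI ballI allI funcsetI)
    fix s assume s: "s \<in> car (cauchy_space V)"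
    show Ts: "(\<lambda>n. T (s n)) \<in> car (cauchy_space W)"
      by (rule bounded_image_Cauchy[OF assms(1-4) s])
    show "vnorm (cauchy_space W) (\<lambda>n. T (s n)) \<le> K * vnorm (cauchy_space V) s"
    proof (rule tendsto_le[OF _ _ W.cauchy_norm_tendsto[OF Ts]])
      show "(\<lambda>n. K * vnorm V (s n)) \<longlonglongrightarrow> K * vnorm (cauchy_space V) s"
        by (intro tendsto_mult_left V.cauchy_norm_tendsto s)
    qed (use s in \<open>auto intro!: always_eventually operator_bounded_byD(2)[OF assms(3)] V.cauchyD\<close>)
  qed (auto simp: V.cauchy_simps W.cauchy_simps V.cauchyD linear_operatorD[OF lin])
  interpret quotient_map "cauchy_space V" "null_seqs V" "cauchy_space W" "null_seqs W" "\<lambda>s n. T (s n)"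
  proof unfold_locales
    show lin': "linear_operator (cauchy_space V) (cauchy_space W) (\<lambda>s n. T (s n))"
      by (rule operator_bounded_byD(1)[OF bnd])
    show "(\<lambda>n. T (s n)) \<in> null_seqs W" if "s \<in> null_seqs V" for s
      using that operator_bounded_byD(2)[OF bnd, of s] linear_operatorD(1)[OF lin', of s]
        CW.norm_ge_0[of "\<lambda>n. T (s n)"]
      by (simp add: V.null_seqs_iff W.null_seqs_iff)
  qed
  show "operator_bounded_by K (completion V) (completion W) (completion_map W T)"
    unfolding completion_def completion_map_def
    by (rule quot_map_bounded_by[OF bnd assms(4) CW.norm_ge_0])
  show "completion_map W T (to_completion V v) = to_completion W (T v)" if "v \<in> car V"
    using quot_map_coset[OF V.cauchy_const[OF that]]
    by (simp add: completion_map_def to_completion_def)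
qed

section \<open>Functoriality of the module tensor product\<close>

text \<open>What the tensor product constructions use of a factor. The projective seminorm is an infimum
  of sums over representations, and so it satisfies the triangle inequality by construction.\<close>

locale prenormed =
  fixes X :: "('x, 'm) nspace_scheme"
  assumes add_in: "\<lbrakk>x \<in> car X; y \<in> car X\<rbrakk> \<Longrightarrow> vadd X x y \<in> car X"
    and scale_in: "x \<in> car X \<Longrightarrow> vscale X c x \<in> car X"
    and norm_ge_0: "x \<in> car X \<Longrightarrow> 0 \<le> vnorm X x"

locale prenormed_module = prenormed X for B :: "'b set" and X :: "('b, 'x) bmodule" +
  assumes act_in: "\<lbrakk>b \<in> B; x \<in> car X\<rbrakk> \<Longrightarrow> act X b x \<in> car X"

subsection \<open>The free space on pairs\<close>

lemma lookup_map_times: "Poly_Mapping.lookup (Poly_Mapping.map ((*) c) u) k = c * Poly_Mapping.lookup u k"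
  for c :: complex
  by transfer (simp add: when_def)

lemma free_space_simps:
  "car (free_space X Y) = {u. Poly_Mapping.keys u \<subseteq> car X \<times> car Y}"
  "vzero (free_space X Y) = 0"
  "vadd (free_space X Y) u v = u + v"
  "vscale (free_space X Y) c u = Poly_Mapping.map ((*) c) u"
  by (simp_all add: free_space_def)

lemma keys_map_times: "Poly_Mapping.keys (Poly_Mapping.map ((*) c) u) \<subseteq> Poly_Mapping.keys u"
  for c :: complex
  by (auto simp: in_keys_iff lookup_map_times)

lemma free_norm_superset:
  assumes "finite A" "Poly_Mapping.keys u \<subseteq> A"
  shows "vnorm (free_space X Y) u = (\<Sum>(x, y)\<in>A. cmod (Poly_Mapping.lookup u (x, y)) * vnorm X x * vnorm Y y)"
  unfolding free_space_def using assms
  by (auto intro!: sum.mono_neutral_left simp: in_keys_iff)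

lemma seminormed_free_space:
  assumes "prenormed X" "prenormed Y"
  shows "seminormed (free_space X Y)"
proof -
  interpret X: prenormed X by fact
  interpret Y: prenormed Y by fact
  show ?thesis
  proof unfold_locales
    fix u v :: "('a \<times> 'c) \<Rightarrow>\<^sub>0 complex" and c
    show "\<lbrakk>u \<in> car (free_space X Y); v \<in> car (free_space X Y)\<rbrakk> \<Longrightarrow> vadd (free_space X Y) u v \<in> car (free_space X Y)"
      using Poly_Mapping.keys_add[of u v] by (auto simp: free_space_simps)
    show "u \<in> car (free_space X Y) \<Longrightarrow> vscale (free_space X Y) c u \<in> car (free_space X Y)"
      using keys_map_times[of c u] by (auto simp: free_space_simps)
    show "u \<in> car (free_space X Y) \<Longrightarrow> 0 \<le> vnorm (free_space X Y) u"
      by (auto simp: free_space_def intro!: sum_nonneg mult_nonneg_nonneg X.norm_ge_0 Y.norm_ge_0)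
    show "vnorm (free_space X Y) (vscale (free_space X Y) c u) = cmod c * vnorm (free_space X Y) u"
      if "u \<in> car (free_space X Y)"
      by (subst (1 2) free_norm_superset[of "Poly_Mapping.keys u"])
        (auto simp: free_space_simps lookup_map_times norm_mult sum_distrib_left mult.assoc
          keys_map_times in_keys_iff intro!: sum.cong)
    show "vnorm (free_space X Y) (vadd (free_space X Y) u v) \<le> vnorm (free_space X Y) u + vnorm (free_space X Y) v"
      if uv: "u \<in> car (free_space X Y)" "v \<in> car (free_space X Y)"
    proof -
      let ?A = "Poly_Mapping.keys u \<union> Poly_Mapping.keys v"
      have "cmod (Poly_Mapping.lookup (u + v) (x, y)) * vnorm X x * vnorm Y y
          \<le> cmod (Poly_Mapping.lookup u (x, y)) * vnorm X x * vnorm Y y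
            + cmod (Poly_Mapping.lookup v (x, y)) * vnorm X x * vnorm Y y"
        if "(x, y) \<in> ?A" for x y
      proof -
        have "0 \<le> vnorm X x * vnorm Y y"
          using that uv by (auto simp: free_space_simps intro!: mult_nonneg_nonneg X.norm_ge_0 Y.norm_ge_0)
        then have "cmod (Poly_Mapping.lookup (u + v) (x, y)) * (vnorm X x * vnorm Y y)
            \<le> (cmod (Poly_Mapping.lookup u (x, y)) + cmod (Poly_Mapping.lookup v (x, y))) * (vnorm X x * vnorm Y y)"
          by (intro mult_right_mono) (auto simp: lookup_add norm_triangle_ineq)
        then show ?thesis by (simp add: algebra_simps)
      qed
      then show ?thesis
        using Poly_Mapping.keys_add[of u v]
        by (simp add: free_space_simps free_norm_superset[of ?A] sum.distrib[symmetric])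
          (auto intro!: sum_mono)
    qed
  qed (auto simp: free_space_simps lookup_map_times lookup_add algebra_simps intro!: poly_mapping_eqI)
qed

lemma poly_mapping_as_sum_single:
  "u = (\<Sum>k\<in>Poly_Mapping.keys u. Poly_Mapping.single k (Poly_Mapping.lookup u k))"
  by (rule poly_mapping_eqI) (simp add: lookup_sum lookup_single when_def in_keys_iff)

lemma scale_pure:
  "vscale (free_space X Y) c (pure x y) = Poly_Mapping.single (x, y) c"
  by (rule poly_mapping_eqI)
    (simp add: free_space_simps pure_def lookup_map_times lookup_single when_def)

lemma free_space_spanned_by_pure:
  assumes "lin_subspace (free_space X Y) W" "\<And>x y. \<lbrakk>x \<in> car X; y \<in> car Y\<rbrakk> \<Longrightarrow> pure x y \<in> W"
    and u: "u \<in> car (free_space X Y)"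
  shows "u \<in> W"
proof -
  have "(\<Sum>k\<in>A. Poly_Mapping.single k (Poly_Mapping.lookup u k)) \<in> W"
    if "finite A" "A \<subseteq> car X \<times> car Y" for A
    using that
  proof (induction A)
    case empty
    then show ?case using assms(1) by (simp add: lin_subspace_def free_space_simps)
  next
    case (insert k A)
    obtain x y where k: "k = (x, y)" by (cases k)
    have "vscale (free_space X Y) (Poly_Mapping.lookup u k) (pure x y) \<in> W"
      using assms(1,2) insert.prems k unfolding lin_subspace_def by blast
    then have "Poly_Mapping.single k (Poly_Mapping.lookup u k) \<in> W"
      by (simp add: scale_pure k)
    moreover have "(\<Sum>k\<in>A. Poly_Mapping.single k (Poly_Mapping.lookup u k)) \<in> W"
      using insert by auto
    ultimately show ?case
      using assms(1) insert.hyps unfolding lin_subspace_def by (simp add: free_space_simps)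
  qed
  from this[of "Poly_Mapping.keys u"] u show ?thesis
    by (simp add: free_space_simps poly_mapping_as_sum_single[symmetric])
qed

definition free_map :: "('x \<Rightarrow> 'y) \<Rightarrow> ('x \<times> 'f \<Rightarrow>\<^sub>0 complex) \<Rightarrow> ('y \<times> 'f \<Rightarrow>\<^sub>0 complex)"
  where "free_map T u = (\<Sum>(x, f)\<in>Poly_Mapping.keys u. Poly_Mapping.single (T x, f) (Poly_Mapping.lookup u (x, f)))"

lemma free_map_superset:
  assumes "finite A" "Poly_Mapping.keys u \<subseteq> A"
  shows "free_map T u = (\<Sum>(x, f)\<in>A. Poly_Mapping.single (T x, f) (Poly_Mapping.lookup u (x, f)))"
  unfolding free_map_def using assms by (auto intro!: sum.mono_neutral_left simp: in_keys_iff)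

lemma free_map_add: "free_map T (u + v) = free_map T u + free_map T v"
proof -
  let ?A = "Poly_Mapping.keys u \<union> Poly_Mapping.keys v"
  show ?thesis
    using Poly_Mapping.keys_add[of u v]
    by (simp add: free_map_superset[of ?A] sum.distrib[symmetric] lookup_add single_add case_prod_unfold)
qed

lemma free_map_diff: "free_map T (u - v) = free_map T u - free_map T v"
  using free_map_add[of T "u - v" v] by simp

lemma free_map_scale: "free_map T (Poly_Mapping.map ((*) c) u) = Poly_Mapping.map ((*) c) (free_map T u)"
  using keys_map_times[of c u]
  by (intro poly_mapping_eqI)
    (simp add: free_map_superset[of "Poly_Mapping.keys u"] lookup_map_times lookup_sum sum_distrib_left
      lookup_single when_def case_prod_unfold if_distrib cong: if_cong)

lemma free_map_pure: "free_map T (pure x f) = pure (T x) f"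
  by (simp add: free_map_def pure_def)

lemma free_map_bounded_by:
  assumes "prenormed X" "prenormed Y" "prenormed F" "T \<in> car X \<rightarrow> car Y"
    and T: "\<And>x. x \<in> car X \<Longrightarrow> vnorm Y (T x) \<le> K * vnorm X x"
  shows "operator_bounded_by K (free_space X F) (free_space Y F) (free_map T)"
proof -
  interpret X: prenormed X by fact
  interpret Y: prenormed Y by fact
  interpret F: prenormed F by fact
  interpret free: seminormed "free_space Y F" by (rule seminormed_free_space) fact+
  have bound: "(\<Sum>(x, f)\<in>A. Poly_Mapping.single (T x, f) (Poly_Mapping.lookup u (x, f))) \<in> car (free_space Y F)
      \<and> vnorm (free_space Y F) (\<Sum>(x, f)\<in>A. Poly_Mapping.single (T x, f) (Poly_Mapping.lookup u (x, f)))
      \<le> K * (\<Sum>(x, f)\<in>A. cmod (Poly_Mapping.lookup u (x, f)) * vnorm X x * vnorm F f)"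
    if "finite A" "A \<subseteq> car X \<times> car F" for A and u :: "'a \<times> 'e \<Rightarrow>\<^sub>0 complex"
    using that
  proof (induction A)
    case empty
    then show ?case by (simp add: free_space_def)
  next
    case (insert k A)
    obtain x f where k: "k = (x, f)" by (cases k)
    with insert have x: "x \<in> car X" and f: "f \<in> car F" by auto
    let ?s = "Poly_Mapping.single (T x, f) (Poly_Mapping.lookup u (x, f))"
    let ?r = "\<Sum>(x, f)\<in>A. Poly_Mapping.single (T x, f) (Poly_Mapping.lookup u (x, f))"
    have s: "?s \<in> car (free_space Y F)"
      using x f assms(4) by (auto simp: free_space_simps split: if_splits)
    have r: "?r \<in> car (free_space Y F)" "vnorm (free_space Y F) ?r
        \<le> K * (\<Sum>(x, f)\<in>A. cmod (Poly_Mapping.lookup u (x, f)) * vnorm X x * vnorm F f)"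
      using insert by auto
    have "vnorm (free_space Y F) ?s = cmod (Poly_Mapping.lookup u (x, f)) * vnorm Y (T x) * vnorm F f"
      by (subst free_norm_superset[of "{(T x, f)}"]) auto
    also have "\<dots> \<le> cmod (Poly_Mapping.lookup u (x, f)) * (K * vnorm X x) * vnorm F f"
      using T[OF x] by (intro mult_right_mono mult_left_mono F.norm_ge_0 f) auto
    finally have "vnorm (free_space Y F) (?s + ?r)
        \<le> K * (\<Sum>(x, f)\<in>insert k A. cmod (Poly_Mapping.lookup u (x, f)) * vnorm X x * vnorm F f)"
      using free.norm_triangle[OF s r(1)] r(2) insert.hyps k by (simp add: free_space_simps algebra_simps)
    moreover have "?s + ?r \<in> car (free_space Y F)"
      using free.add_in[OF s r(1)] by (simp add: free_space_simps)
    ultimately show ?case using insert.hyps k by simp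
  qed
  have "free_map T u \<in> car (free_space Y F) \<and> vnorm (free_space Y F) (free_map T u) \<le> K * vnorm (free_space X F) u"
    if "u \<in> car (free_space X F)" for u
    using bound[of "Poly_Mapping.keys u" u] that
    by (simp add: free_map_def free_space_def)
  then show ?thesis
    by (auto simp: operator_bounded_by_def linear_operator_def)
      (simp_all add: free_space_simps free_map_add free_map_scale)
qed

subsection \<open>The projective tensor product\<close>

lemma pure_in: "\<lbrakk>x \<in> car X; y \<in> car Y\<rbrakk> \<Longrightarrow> pure x y \<in> car (free_space X Y)"
  by (simp add: pure_def free_space_simps)

lemma bilinear_relations_in:
  assumes "prenormed X" "prenormed Y"
  shows "bilinear_relations X Y \<subseteq> car (free_space X Y)"
proof -
  interpret X: prenormed X by fact
  interpret Y: prenormed Y by fact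
  interpret free: seminormed "free_space X Y" by (rule seminormed_free_space) fact+
  have diff: "u - v \<in> car (free_space X Y)" if "u \<in> car (free_space X Y)" "v \<in> car (free_space X Y)" for u v
    using that keys_diff[of u v] by (auto simp: free_space_simps)
  show ?thesis
    unfolding bilinear_relations_def
    by (auto intro!: diff free.scale_in pure_in X.add_in Y.add_in X.scale_in Y.scale_in)
qed

lemma alg_tensor_quotient:
  assumes "prenormed X" "prenormed Y"
  shows "seminormed_quotient (free_space X Y) (lin_span (free_space X Y) (bilinear_relations X Y))"
proof -
  interpret free: seminormed "free_space X Y" by (rule seminormed_free_space) fact+
  show ?thesis
    by unfold_locales (intro lin_span_subspace free.vspace_axioms bilinear_relations_in assms)
qed

lemma seminormed_alg_tensor: "\<lbrakk>prenormed X; prenormed Y\<rbrakk> \<Longrightarrow> seminormed (alg_tensor X Y)"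
  unfolding alg_tensor_def by (rule seminormed_quotient.seminormed_quot[OF alg_tensor_quotient])

lemma seminormed_proj_tensor: "\<lbrakk>prenormed X; prenormed Y\<rbrakk> \<Longrightarrow> seminormed (proj_tensor X Y)"
  unfolding proj_tensor_def by (rule seminormed.seminormed_completion[OF seminormed_alg_tensor])

text \<open>The image is dense in the completed tensor product and is spanned by the elementary tensors, so
  that bounded operators can be compared on it.\<close>

definition free_to_proj :: "('x, 'm) nspace_scheme \<Rightarrow> ('y, 'n) nspace_scheme
    \<Rightarrow> ('x \<times> 'y \<Rightarrow>\<^sub>0 complex) \<Rightarrow> ('x, 'y) ptensor"
  where "free_to_proj X Y u = to_completion (alg_tensor X Y)
    (vcoset (free_space X Y) (lin_span (free_space X Y) (bilinear_relations X Y)) u)"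

lemma proj_pure_eq: "proj_pure X Y x y = free_to_proj X Y (pure x y)"
  by (simp add: proj_pure_def free_to_proj_def alg_pure_def)

lemma free_to_proj_linear:
  assumes "prenormed X" "prenormed Y"
  shows "linear_operator (free_space X Y) (proj_tensor X Y) (free_to_proj X Y)"
proof -
  interpret seminormed_quotient "free_space X Y" "lin_span (free_space X Y) (bilinear_relations X Y)"
    by (rule alg_tensor_quotient) fact+
  note lin = operator_bounded_byD(1)[OF coset_map_bounded_by]
    and lin' = seminormed.to_completion_linear[OF seminormed_alg_tensor[OF assms]]
  show ?thesis
    using linear_operatorD[OF lin] linear_operatorD[OF lin']
    unfolding linear_operator_def free_to_proj_def proj_tensor_def alg_tensor_def by auto
qed

lemma free_to_proj_dense:
  assumes "prenormed X" "prenormed Y" "z \<in> car (proj_tensor X Y)" "0 < e"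
  obtains u where "u \<in> car (free_space X Y)"
    "vnorm (proj_tensor X Y) (vminus (proj_tensor X Y) z (free_to_proj X Y u)) < e"
proof -
  interpret seminormed_quotient "free_space X Y" "lin_span (free_space X Y) (bilinear_relations X Y)"
    by (rule alg_tensor_quotient) fact+
  obtain v where v: "v \<in> car (alg_tensor X Y)"
    "vnorm (proj_tensor X Y) (vminus (proj_tensor X Y) z (to_completion (alg_tensor X Y) v)) < e"
    using seminormed.completion_approx[OF seminormed_alg_tensor[OF assms(1,2)]] assms(3,4)
    unfolding proj_tensor_def by metis
  then show thesis
    using that unfolding alg_tensor_def free_to_proj_def by (auto elim: quot_carE)
qed

definition proj_map :: "('y, 'n) nspace_scheme \<Rightarrow> ('f, 'o) nspace_scheme \<Rightarrow> ('x \<Rightarrow> 'y)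
    \<Rightarrow> ('x, 'f) ptensor \<Rightarrow> ('y, 'f) ptensor"
  where "proj_map Y F T = completion_map (alg_tensor Y F)
    (quot_map (free_space Y F) (lin_span (free_space Y F) (bilinear_relations Y F)) (free_map T))"

lemma proj_map:
  assumes "prenormed X" "prenormed Y" "prenormed F" "operator_bounded_by K X Y T" "0 \<le> K"
  shows "operator_bounded_by K (proj_tensor X F) (proj_tensor Y F) (proj_map Y F T)"
    and "\<lbrakk>x \<in> car X; f \<in> car F\<rbrakk> \<Longrightarrow> proj_map Y F T (proj_pure X F x f) = proj_pure Y F (T x) f"
proof -
  note lin = operator_bounded_byD(1)[OF assms(4)]
  interpret X: seminormed_quotient "free_space X F" "lin_span (free_space X F) (bilinear_relations X F)"
    by (rule alg_tensor_quotient) fact+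
  interpret Y: seminormed_quotient "free_space Y F" "lin_span (free_space Y F) (bilinear_relations Y F)"
    by (rule alg_tensor_quotient) fact+
  have free: "operator_bounded_by K (free_space X F) (free_space Y F) (free_map T)"
    using assms(1-4) lin by (intro free_map_bounded_by operator_bounded_byD(2)) (auto simp: linear_operator_def)
  have rel: "free_map T r \<in> bilinear_relations Y F" if r: "r \<in> bilinear_relations X F" for r
  proof -
    consider x x' f where "x \<in> car X" "x' \<in> car X" "f \<in> car F" "r = pure (vadd X x x') f - pure x f - pure x' f"
      | x f f' where "x \<in> car X" "f \<in> car F" "f' \<in> car F" "r = pure x (vadd F f f') - pure x f - pure x f'"
      | c x f where "x \<in> car X" "f \<in> car F" "r = pure (vscale X c x) f - vscale (free_space X F) c (pure x f)"
      | c x f where "x \<in> car X" "f \<in> car F" "r = pure x (vscale F c f) - vscale (free_space X F) c (pure x f)"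
      using r unfolding bilinear_relations_def by blast
    then show ?thesis
    proof cases
      case 1
      then have "free_map T r = pure (vadd Y (T x) (T x')) f - pure (T x) f - pure (T x') f"
        by (simp add: free_map_diff free_map_pure linear_operatorD[OF lin])
      with 1 show ?thesis unfolding bilinear_relations_def using linear_operatorD(1)[OF lin] by blast
    next
      case 2
      then have "free_map T r = pure (T x) (vadd F f f') - pure (T x) f - pure (T x) f'"
        by (simp add: free_map_diff free_map_pure)
      with 2 show ?thesis unfolding bilinear_relations_def using linear_operatorD(1)[OF lin] by blast
    next
      case 3
      then have "free_map T r = pure (vscale Y c (T x)) f - vscale (free_space Y F) c (pure (T x) f)"
        by (simp add: free_map_diff free_map_pure free_map_scale free_space_simps linear_operatorD[OF lin])
      with 3 show ?thesis unfolding bilinear_relations_def using linear_operatorD(1)[OF lin] by blast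
    next
      case 4
      then have "free_map T r = pure (T x) (vscale F c f) - vscale (free_space Y F) c (pure (T x) f)"
        by (simp add: free_map_diff free_map_pure free_map_scale free_space_simps)
      with 4 show ?thesis unfolding bilinear_relations_def using linear_operatorD(1)[OF lin] by blast
    qed
  qed
  interpret quotient_map "free_space X F" "lin_span (free_space X F) (bilinear_relations X F)"
    "free_space Y F" "lin_span (free_space Y F) (bilinear_relations Y F)" "free_map T"
  proof unfold_locales
    show lin': "linear_operator (free_space X F) (free_space Y F) (free_map T)"
      by (rule operator_bounded_byD(1)[OF free])
    show "free_map T n \<in> lin_span (free_space Y F) (bilinear_relations Y F)"
      if "n \<in> lin_span (free_space X F) (bilinear_relations X F)" for n
      by (rule lin_span_image[OF X.vspace_axioms Y.vspace_axioms lin' bilinear_relations_in[OF assms(1,3)]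
            bilinear_relations_in[OF assms(2,3)] rel that])
  qed
  have alg: "operator_bounded_by K (alg_tensor X F) (alg_tensor Y F)
      (quot_map (free_space Y F) (lin_span (free_space Y F) (bilinear_relations Y F)) (free_map T))"
    unfolding alg_tensor_def by (rule quot_map_bounded_by[OF free assms(5) Y.norm_ge_0])
  note completed = completion_map[OF seminormed_alg_tensor[OF assms(1,3)] seminormed_alg_tensor[OF assms(2,3)]
      alg assms(5)]
  show "operator_bounded_by K (proj_tensor X F) (proj_tensor Y F) (proj_map Y F T)"
    unfolding proj_tensor_def proj_map_def by (rule completed(1))
  show "proj_map Y F T (proj_pure X F x f) = proj_pure Y F (T x) f" if "x \<in> car X" "f \<in> car F"
    using that completed(2)[of "alg_pure X F x f"]
    by (simp add: proj_map_def proj_pure_def alg_pure_def alg_tensor_def X.coset_in pure_in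
        quot_map_coset free_map_pure)
qed

subsection \<open>The module tensor product\<close>

lemma proj_pure_in:
  assumes "prenormed X" "prenormed Y" "x \<in> car X" "y \<in> car Y"
  shows "proj_pure X Y x y \<in> car (proj_tensor X Y)"
  using linear_operatorD(1)[OF free_to_proj_linear[OF assms(1,2)] pure_in[OF assms(3,4)]]
  by (simp add: proj_pure_eq)

lemma balancing_elements_in:
  assumes "prenormed_module B X" "prenormed_module B F"
  shows "{vminus (proj_tensor X F) (proj_pure X F (act X b x) f) (proj_pure X F x (act F b f)) | b x f.
      b \<in> B \<and> x \<in> car X \<and> f \<in> car F} \<subseteq> car (proj_tensor X F)"
proof -
  interpret X: prenormed_module B X by fact
  interpret F: prenormed_module B F by fact
  interpret seminormed "proj_tensor X F"
    by (intro seminormed_proj_tensor X.prenormed_axioms F.prenormed_axioms)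
  show ?thesis
    by (auto intro!: minus_in proj_pure_in X.prenormed_axioms F.prenormed_axioms X.act_in F.act_in)
qed

lemma module_tensor_quotient:
  assumes "prenormed_module B X" "prenormed_module B F"
  shows "seminormed_quotient (proj_tensor X F) (balancing_span B X F)"
    and "norm_closed (proj_tensor X F) (balancing_span B X F)"
proof -
  interpret X: prenormed_module B X by fact
  interpret F: prenormed_module B F by fact
  interpret P: seminormed "proj_tensor X F"
    by (intro seminormed_proj_tensor X.prenormed_axioms F.prenormed_axioms)
  note span = closed_lin_span_subspace[OF P.vspace_axioms balancing_elements_in[OF assms]]
  show "seminormed_quotient (proj_tensor X F) (balancing_span B X F)"
    unfolding balancing_span_def by unfold_locales (rule span(1))
  show "norm_closed (proj_tensor X F) (balancing_span B X F)"
    unfolding balancing_span_def by (rule span(2))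
qed

lemma seminormed_module_tensor:
  "\<lbrakk>prenormed_module B X; prenormed_module B F\<rbrakk> \<Longrightarrow> seminormed (module_tensor B X F)"
  unfolding module_tensor_def by (rule seminormed_quotient.seminormed_quot[OF module_tensor_quotient(1)])

lemma module_pure_in:
  assumes "prenormed_module B X" "prenormed_module B F" "x \<in> car X" "f \<in> car F"
  shows "module_pure B X F x f \<in> car (module_tensor B X F)"
proof -
  interpret X: prenormed_module B X by fact
  interpret F: prenormed_module B F by fact
  interpret seminormed_quotient "proj_tensor X F" "balancing_span B X F"
    by (rule module_tensor_quotient) fact+
  show ?thesis
    unfolding module_tensor_def module_pure_def
    by (intro coset_in proj_pure_in X.prenormed_axioms F.prenormed_axioms assms)
qed

lemma module_tensor_norm_zero_imp:
  assumes "prenormed_module B X" "prenormed_module B F" "w \<in> car (module_tensor B X F)"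
    and "vnorm (module_tensor B X F) w = 0"
  shows "w = vzero (module_tensor B X F)"
proof -
  interpret seminormed_quotient "proj_tensor X F" "balancing_span B X F"
    by (rule module_tensor_quotient) fact+
  show ?thesis
    using assms(3,4) quot_norm_zero_imp[OF module_tensor_quotient(2)[OF assms(1,2)]]
    unfolding module_tensor_def by (auto elim!: quot_carE)
qed

text \<open>The operators agree on the span of the elementary tensors, which is dense. At a point within e
  of this span their values differ by at most (K + L) e in norm, and the norm of the target is
  definite.\<close>

lemma module_tensor_operator_unique:
  assumes "prenormed_module B X" "prenormed_module B F" "seminormed W"
    and definite: "\<And>w. \<lbrakk>w \<in> car W; vnorm W w = 0\<rbrakk> \<Longrightarrow> w = vzero W"
    and R: "bounded_operator (module_tensor B X F) W R"
    and S: "bounded_operator (module_tensor B X F) W S"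
    and agree: "\<And>x f. \<lbrakk>x \<in> car X; f \<in> car F\<rbrakk> \<Longrightarrow> R (module_pure B X F x f) = S (module_pure B X F x f)"
    and z: "z \<in> car (module_tensor B X F)"
  shows "R z = S z"
proof -
  interpret X: prenormed_module B X by fact
  interpret F: prenormed_module B F by fact
  interpret W: seminormed W by fact
  interpret Q: seminormed_quotient "proj_tensor X F" "balancing_span B X F"
    by (rule module_tensor_quotient) fact+
  interpret M: seminormed "module_tensor B X F" by (rule seminormed_module_tensor) fact+
  interpret free: seminormed "free_space X F"
    by (intro seminormed_free_space X.prenormed_axioms F.prenormed_axioms)
  obtain K where K: "0 \<le> K" "operator_bounded_by K (module_tensor B X F) W R"
    using bounded_operator_nonneg_bound[OF R M.norm_ge_0] by blast
  obtain L where L: "0 \<le> L" "operator_bounded_by L (module_tensor B X F) W S"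
    using bounded_operator_nonneg_bound[OF S M.norm_ge_0] by blast
  note Rlin = operator_bounded_byD(1)[OF K(2)] and Slin = operator_bounded_byD(1)[OF L(2)]
  define j where "j u = vcoset (proj_tensor X F) (balancing_span B X F) (free_to_proj X F u)" for u
  note toproj = free_to_proj_linear[OF X.prenormed_axioms F.prenormed_axioms]
    and coset = operator_bounded_byD(1)[OF Q.coset_map_bounded_by]
  have jlin: "linear_operator (free_space X F) (module_tensor B X F) j"
    using linear_operatorD[OF toproj] linear_operatorD[OF coset]
    unfolding linear_operator_def j_def module_tensor_def by auto
  have dense: "R (j u) = S (j u)" if u: "u \<in> car (free_space X F)" for u
  proof -
    let ?W = "{u \<in> car (free_space X F). R (j u) = S (j u)}"
    have "lin_subspace (free_space X F) ?W"
      unfolding lin_subspace_def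
      using linear_operatorD[OF jlin] linear_operatorD[OF Rlin] linear_operatorD[OF Slin]
        linear_operator_zero[OF jlin free.vspace_axioms M.vspace_axioms]
        linear_operator_zero[OF Rlin M.vspace_axioms W.vspace_axioms]
        linear_operator_zero[OF Slin M.vspace_axioms W.vspace_axioms]
      by (auto simp: free.zero_in free.add_in free.scale_in)
    moreover have "pure x f \<in> ?W" if "x \<in> car X" "f \<in> car F" for x f
      using agree[OF that] that by (simp add: pure_in j_def module_pure_def proj_pure_eq)
    ultimately have "u \<in> ?W" using free_space_spanned_by_pure u by blast
    then show ?thesis by simp
  qed
  have Rz: "R z \<in> car W" and Sz: "S z \<in> car W" using linear_operatorD(1)[OF Rlin z] linear_operatorD(1)[OF Slin z] by auto
  have "vnorm W (vminus W (R z) (S z)) \<le> 0 + e" if "0 < e" for e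
  proof -
    obtain y where y: "y \<in> car (proj_tensor X F)" "z = vcoset (proj_tensor X F) (balancing_span B X F) y"
      using z unfolding module_tensor_def by (rule Q.quot_carE)
    have "0 < e / (K + L + 1)" using that K L by simp
    then obtain u where u: "u \<in> car (free_space X F)"
      "vnorm (proj_tensor X F) (vminus (proj_tensor X F) y (free_to_proj X F u)) < e / (K + L + 1)"
      using free_to_proj_dense[OF X.prenormed_axioms F.prenormed_axioms y(1)] by blast
    have ju: "j u \<in> car (module_tensor B X F)" by (rule linear_operatorD(1)[OF jlin u(1)])
    have u': "free_to_proj X F u \<in> car (proj_tensor X F)" by (rule linear_operatorD(1)[OF toproj u(1)])
    have "vnorm (module_tensor B X F) (vminus (module_tensor B X F) z (j u))
        \<le> vnorm (proj_tensor X F) (vminus (proj_tensor X F) y (free_to_proj X F u))"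
      unfolding module_tensor_def y(2) j_def Q.quot_minus[OF y(1) u']
      by (intro Q.quot_norm_le Q.norm_ge_0 Q.coset_self Q.minus_in y(1) u')
    with u(2) have near: "vnorm (module_tensor B X F) (vminus (module_tensor B X F) z (j u)) \<le> e / (K + L + 1)"
      by simp
    let ?d = "vminus (module_tensor B X F) z (j u)"
    have d: "?d \<in> car (module_tensor B X F)" by (rule M.minus_in[OF z ju])
    have Rj: "R (j u) \<in> car W" by (rule linear_operatorD(1)[OF Rlin ju])
    have "vnorm W (vminus W (R z) (S z))
        \<le> vnorm W (vminus W (R z) (R (j u))) + vnorm W (vminus W (R (j u)) (S z))"
      by (rule W.norm_minus_triangle[OF Rz Rj Sz])
    also have "vnorm W (vminus W (R (j u)) (S z)) = vnorm W (vminus W (S z) (S (j u)))"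
      unfolding dense[OF u(1), symmetric] by (rule W.norm_minus_commute[OF Rj Sz])
    also have "vnorm W (vminus W (R z) (R (j u))) = vnorm W (R ?d)"
      using linear_operator_minus[OF Rlin M.vspace_axioms z ju] by simp
    also have "vnorm W (vminus W (S z) (S (j u))) = vnorm W (S ?d)"
      using linear_operator_minus[OF Slin M.vspace_axioms z ju] by simp
    also have "vnorm W (R ?d) + vnorm W (S ?d) \<le> (K + L) * vnorm (module_tensor B X F) ?d"
      using operator_bounded_byD(2)[OF K(2) d] operator_bounded_byD(2)[OF L(2) d]
      by (simp add: algebra_simps)
    also have "\<dots> \<le> (K + L) * (e / (K + L + 1))"
      using near K(1) L(1) by (intro mult_left_mono) auto
    also have "\<dots> \<le> e" using K(1) L(1) that by (simp add: field_simps)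
    finally show ?thesis by simp
  qed
  then have "vnorm W (vminus W (R z) (S z)) \<le> 0" by (rule field_le_epsilon)
  then have "vminus W (R z) (S z) = vzero W"
    using definite[of "vminus W (R z) (S z)"] W.norm_ge_0[of "vminus W (R z) (S z)"] W.minus_in[OF Rz Sz]
    by simp
  then show ?thesis using W.add_minus_cancel[OF Rz Sz] W.add_zero[OF Sz] by simp
qed

text \<open>The map on the completed tensor product respects the balancing relations, because T is a module
  map, hence also their closed span, because it is bounded. The operator induced on the quotients
  has the properties by which the tensor product of maps is described, and uniqueness identifies
  the two.\<close>

lemma tensor_map_props:
  assumes "prenormed_module B X" "prenormed_module B Y" "prenormed_module B F"
    and T: "module_map B X Y T" "operator_bounded_by K X Y T" "0 \<le> K"
  shows "operator_bounded_by K (module_tensor B X F) (module_tensor B Y F) (tensor_map B X F Y F T (\<lambda>f. f))"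
    and "\<lbrakk>x \<in> car X; f \<in> car F\<rbrakk> \<Longrightarrow>
      tensor_map B X F Y F T (\<lambda>f. f) (module_pure B X F x f) = module_pure B Y F (T x) f"
proof -
  interpret X: prenormed_module B X by fact
  interpret Y: prenormed_module B Y by fact
  interpret F: prenormed_module B F by fact
  interpret QX: seminormed_quotient "proj_tensor X F" "balancing_span B X F"
    by (rule module_tensor_quotient) fact+
  interpret QY: seminormed_quotient "proj_tensor Y F" "balancing_span B Y F"
    by (rule module_tensor_quotient) fact+
  note proj = proj_map[OF X.prenormed_axioms Y.prenormed_axioms F.prenormed_axioms T(2,3)]
  note projlin = operator_bounded_byD(1)[OF proj(1)]
    and pureX = proj_pure_in[OF X.prenormed_axioms F.prenormed_axioms]
    and TY = linear_operatorD(1)[OF operator_bounded_byD(1)[OF T(2)]]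
  interpret quotient_map "proj_tensor X F" "balancing_span B X F" "proj_tensor Y F" "balancing_span B Y F"
    "proj_map Y F T"
  proof unfold_locales
    show "linear_operator (proj_tensor X F) (proj_tensor Y F) (proj_map Y F T)" by (rule projlin)
    fix n assume "n \<in> balancing_span B X F"
    then show "proj_map Y F T n \<in> balancing_span B Y F"
      unfolding balancing_span_def
    proof (rule closed_lin_span_image[OF QX.seminormed_axioms QY.seminormed_axioms proj(1)
          balancing_elements_in[OF assms(1,3)] balancing_elements_in[OF assms(2,3)], rotated])
      fix s assume "s \<in> {vminus (proj_tensor X F) (proj_pure X F (act X b x) f) (proj_pure X F x (act F b f)) | b x f.
        b \<in> B \<and> x \<in> car X \<and> f \<in> car F}"
      then obtain b x f where *: "b \<in> B" "x \<in> car X" "f \<in> car F"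
        "s = vminus (proj_tensor X F) (proj_pure X F (act X b x) f) (proj_pure X F x (act F b f))" by blast
      then have "proj_map Y F T s
          = vminus (proj_tensor Y F) (proj_pure Y F (T (act X b x)) f) (proj_pure Y F (T x) (act F b f))"
        by (simp add: linear_operator_minus[OF projlin QX.vspace_axioms] pureX X.act_in F.act_in proj(2))
      also have "T (act X b x) = act Y b (T x)" using T(1) * by (simp add: module_map_def)
      finally show "proj_map Y F T s \<in> {vminus (proj_tensor Y F) (proj_pure Y F (act Y b x) f)
          (proj_pure Y F x (act F b f)) | b x f. b \<in> B \<and> x \<in> car Y \<and> f \<in> car F}"
        using * TY by blast
    qed
  qed
  let ?MX = "module_tensor B X F" and ?MY = "module_tensor B Y F"
  define R where "R = restrict (quot_map (proj_tensor Y F) (balancing_span B Y F) (proj_map Y F T)) (car ?MX)"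
  interpret MX: seminormed ?MX by (rule seminormed_module_tensor) fact+
  have "operator_bounded_by K ?MX ?MY (quot_map (proj_tensor Y F) (balancing_span B Y F) (proj_map Y F T))"
    unfolding module_tensor_def by (rule quot_map_bounded_by[OF proj(1) T(3) QY.norm_ge_0])
  then have R: "operator_bounded_by K ?MX ?MY R"
    by (auto simp: R_def operator_bounded_by_def linear_operator_def MX.add_in MX.scale_in)
  have R_pure: "\<forall>x\<in>car X. \<forall>f\<in>car F. R (module_pure B X F x f) = module_pure B Y F (T x) f"
  proof (intro ballI)
    fix x f assume xf: "x \<in> car X" "f \<in> car F"
    then show "R (module_pure B X F x f) = module_pure B Y F (T x) f"
      using module_pure_in[OF assms(1,3) xf]
      by (simp add: R_def) (simp add: module_pure_def quot_map_coset pureX proj(2))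
  qed
  have tensor_map: "tensor_map B X F Y F T (\<lambda>f. f) = R"
    unfolding tensor_map_def
  proof (rule the_equality, intro conjI R_pure operator_bounded_by_imp_bounded[OF R])
    show "R \<in> extensional (car ?MX)" by (simp add: R_def)
    fix S assume S: "S \<in> extensional (car ?MX) \<and> bounded_operator ?MX ?MY S
      \<and> (\<forall>x\<in>car X. \<forall>f\<in>car F. S (module_pure B X F x f) = module_pure B Y F (T x) f)"
    show "S = R"
    proof (rule extensionalityI)
      show "S \<in> extensional (car ?MX)" using S by simp
      show "R \<in> extensional (car ?MX)" by (simp add: R_def)
      show "S z = R z" if "z \<in> car ?MX" for z
        by (rule module_tensor_operator_unique[OF assms(1,3) seminormed_module_tensor[OF assms(2,3)]
              module_tensor_norm_zero_imp[OF assms(2,3)] _ operator_bounded_by_imp_bounded[OF R] _ that])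
          (use S R_pure in auto)
    qed
  qed
  show "operator_bounded_by K ?MX ?MY (tensor_map B X F Y F T (\<lambda>f. f))"
    using R tensor_map by simp
  show "tensor_map B X F Y F T (\<lambda>f. f) (module_pure B X F x f) = module_pure B Y F (T x) f"
    if "x \<in> car X" "f \<in> car F"
    using R_pure tensor_map that by simp
qed

text \<open>The composition of the two tensored maps fixes all elementary tensors, so it is the identity by
  uniqueness. The bound of the tensored left inverse then becomes a lower bound.\<close>

lemma tensor_map_of_retract:
  assumes "prenormed_module B X" "prenormed_module B Y" "prenormed_module B F"
    and S: "module_map B X Y S" "operator_bounded_by K X Y S" "0 \<le> K"
    and T: "module_map B Y X T" "operator_bounded_by L Y X T" "0 \<le> L"
    and left_inverse: "\<And>x. x \<in> car X \<Longrightarrow> T (S x) = x"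
  shows "operator_bounded_by K (module_tensor B X F) (module_tensor B Y F) (tensor_map B X F Y F S (\<lambda>f. f))"
    and "z \<in> car (module_tensor B X F) \<Longrightarrow> vnorm (module_tensor B X F) z
      \<le> L * vnorm (module_tensor B Y F) (tensor_map B X F Y F S (\<lambda>f. f) z)"
proof -
  let ?MX = "module_tensor B X F" and ?MY = "module_tensor B Y F"
  let ?S = "tensor_map B X F Y F S (\<lambda>f. f)" and ?T = "tensor_map B Y F X F T (\<lambda>f. f)"
  interpret MX: seminormed ?MX by (rule seminormed_module_tensor) fact+
  note S' = tensor_map_props[OF assms(1-3) S]
  note T' = tensor_map_props[OF assms(2,1,3) T]
  show "operator_bounded_by K ?MX ?MY ?S" by (rule S'(1))
  have SY: "S x \<in> car Y" if "x \<in> car X" for x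
    using that linear_operatorD(1)[OF operator_bounded_byD(1)[OF S(2)]] by blast
  assume z: "z \<in> car ?MX"
  have "?T (?S z) = z"
  proof (rule module_tensor_operator_unique[OF assms(1,3) MX.seminormed_axioms
        module_tensor_norm_zero_imp[OF assms(1,3)] _ _ _ z])
    show "bounded_operator ?MX ?MX (\<lambda>z. ?T (?S z))"
      by (rule operator_bounded_by_imp_bounded[OF operator_bounded_by_compose[OF S'(1) T'(1) T(3)]])
    show "bounded_operator ?MX ?MX (\<lambda>z. z)"
      by (rule operator_bounded_by_imp_bounded[of 1]) (simp add: operator_bounded_by_def linear_operator_def)
    show "?T (?S (module_pure B X F x f)) = module_pure B X F x f" if "x \<in> car X" "f \<in> car F" for x f
      using that by (simp add: S'(2) T'(2) SY left_inverse)
  qed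
  moreover have "?S z \<in> car ?MY" by (rule linear_operatorD(1)[OF operator_bounded_byD(1)[OF S'(1)] z])
  ultimately show "vnorm ?MX z \<le> L * vnorm ?MY (?S z)"
    using operator_bounded_byD(2)[OF T'(1), of "?S z"] by simp
qed

section \<open>The spaces of p-integrable functions\<close>

locale Lp_space = finite_measure M for M :: "'a measure" +
  fixes p :: ennreal
  assumes exponent_ge_1: "1 \<le> p"
begin

abbreviation r where "r \<equiv> enn2real p"

lemma r_ge_1: "p \<noteq> \<infinity> \<Longrightarrow> 1 \<le> r"
  using exponent_ge_1 by (cases p rule: ennreal_cases) auto

lemma pre_Lp_simps:
  "vzero (pre_Lp M p) = (\<lambda>_. 0)"
  "vadd (pre_Lp M p) f g = (\<lambda>x. f x + g x)"
  "vscale (pre_Lp M p) c f = (\<lambda>x. c * f x)"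
  "vminus (pre_Lp M p) f g = (\<lambda>x. f x - g x)"
  by (simp_all add: pre_Lp_def vminus_def)

lemma norm_ge_0: "0 \<le> vnorm (pre_Lp M p) f"
  by (simp add: pre_Lp_def)

lemma car_measurable: "f \<in> car (pre_Lp M p) \<Longrightarrow> f \<in> borel_measurable M"
  by (simp add: pre_Lp_def)

text \<open>Membership and norm bound in one condition without integrability hypotheses, so that it
  behaves well under almost everywhere comparison and monotone limits.\<close>

lemma norm_le_iff:
  assumes "0 \<le> C"
  shows "f \<in> car (pre_Lp M p) \<and> vnorm (pre_Lp M p) f \<le> C \<longleftrightarrow> f \<in> borel_measurable M \<and>
    (if p = \<infinity> then AE x in M. cmod (f x) \<le> C
     else (\<integral>\<^sup>+x. ennreal (cmod (f x) powr r) \<partial>M) \<le> ennreal (C powr r))"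
    (is "?L \<longleftrightarrow> ?R")
proof (cases "f \<in> borel_measurable M")
  case f[measurable]: True
  show ?thesis
  proof (cases "p = \<infinity>")
    case True
    let ?s = "esssup M (\<lambda>x. ennreal (cmod (f x)))"
    have "?s < \<infinity> \<and> enn2real ?s \<le> C \<longleftrightarrow> ?s \<le> ennreal C"
      using assms by (cases ?s rule: ennreal_cases) (auto simp: top_unique)
    also have "\<dots> \<longleftrightarrow> (AE x in M. ennreal (cmod (f x)) \<le> ennreal C)"
    proof
      assume "?s \<le> ennreal C"
      then show "AE x in M. ennreal (cmod (f x)) \<le> ennreal C"
        using esssup_AE[of "\<lambda>x. ennreal (cmod (f x))" M] by (auto elim: order_trans)
    qed (intro esssup_I, simp_all)
    finally show ?thesis using True f assms by (simp add: pre_Lp_def)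
  next
    case False
    note r = r_ge_1[OF False]
    let ?I = "LINT x|M. cmod (f x) powr r"
    have I: "0 \<le> ?I" by simp
    show ?thesis
    proof
      assume L: ?L
      then have int: "integrable M (\<lambda>x. cmod (f x) powr r)" and le: "?I powr (1 / r) \<le> C"
        using False by (auto simp: pre_Lp_def)
      have "?I = (?I powr (1 / r)) powr r" using r I by (simp add: powr_powr)
      also have "\<dots> \<le> C powr r" using le r by (intro powr_mono2) auto
      finally show ?R using False by (simp add: nn_integral_eq_integral[OF int])
    next
      assume ?R
      then have le: "(\<integral>\<^sup>+x. ennreal (cmod (f x) powr r) \<partial>M) \<le> ennreal (C powr r)" using False by simp
      then have int: "integrable M (\<lambda>x. cmod (f x) powr r)"
        by (intro integrableI_nonneg) (auto intro: le_less_trans)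
      then have "?I \<le> C powr r" using le by (simp add: nn_integral_eq_integral)
      then have "?I powr (1 / r) \<le> (C powr r) powr (1 / r)" using r I by (intro powr_mono2) auto
      also have "\<dots> = C" using r assms by (simp add: powr_powr)
      finally show ?L using False int by (simp add: pre_Lp_def)
    qed
  qed
qed (auto simp: pre_Lp_def)

lemma norm_bound_self:
  assumes "f \<in> car (pre_Lp M p)"
  shows "if p = \<infinity> then AE x in M. cmod (f x) \<le> vnorm (pre_Lp M p) f
    else (\<integral>\<^sup>+x. ennreal (cmod (f x) powr r) \<partial>M) \<le> ennreal (vnorm (pre_Lp M p) f powr r)"
  using norm_le_iff[OF norm_ge_0[of f], of f] assms order.refl by blast

lemma norm_dominated:
  assumes "h \<in> car (pre_Lp M p)" "f \<in> borel_measurable M" "AE x in M. cmod (f x) \<le> cmod (h x)"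
  shows "f \<in> car (pre_Lp M p)" "vnorm (pre_Lp M p) f \<le> vnorm (pre_Lp M p) h"
proof -
  let ?C = "vnorm (pre_Lp M p) h"
  have h: "if p = \<infinity> then AE x in M. cmod (h x) \<le> ?C
      else (\<integral>\<^sup>+x. ennreal (cmod (h x) powr r) \<partial>M) \<le> ennreal (?C powr r)"
    by (rule norm_bound_self[OF assms(1)])
  have "f \<in> car (pre_Lp M p) \<and> vnorm (pre_Lp M p) f \<le> ?C"
    unfolding norm_le_iff[OF norm_ge_0]
  proof (intro conjI assms(2))
    show "if p = \<infinity> then AE x in M. cmod (f x) \<le> ?C
        else (\<integral>\<^sup>+x. ennreal (cmod (f x) powr r) \<partial>M) \<le> ennreal (?C powr r)"
    proof (cases "p = \<infinity>")
      case True
      with h have "AE x in M. cmod (h x) \<le> ?C" by simp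
      with assms(3) True show ?thesis by auto
    next
      case False
      have "(\<integral>\<^sup>+x. ennreal (cmod (f x) powr r) \<partial>M) \<le> (\<integral>\<^sup>+x. ennreal (cmod (h x) powr r) \<partial>M)"
        using assms(3) r_ge_1[OF False]
        by (intro nn_integral_mono_AE) (auto elim!: eventually_mono intro!: powr_mono2)
      with h False show ?thesis by auto
    qed
  qed
  then show "f \<in> car (pre_Lp M p)" "vnorm (pre_Lp M p) f \<le> ?C" by auto
qed

lemma norm_AE_cong:
  assumes "h \<in> car (pre_Lp M p)" "f \<in> borel_measurable M" "AE x in M. f x = h x"
  shows "f \<in> car (pre_Lp M p)" "vnorm (pre_Lp M p) f = vnorm (pre_Lp M p) h"
proof -
  have le: "AE x in M. cmod (f x) \<le> cmod (h x)" "AE x in M. cmod (h x) \<le> cmod (f x)"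
    using assms(3) by auto
  show f: "f \<in> car (pre_Lp M p)" by (rule norm_dominated[OF assms(1,2) le(1)])
  show "vnorm (pre_Lp M p) f = vnorm (pre_Lp M p) h"
    using norm_dominated(2)[OF assms(1,2) le(1)] norm_dominated(2)[OF f car_measurable[OF assms(1)] le(2)]
    by simp
qed

lemma norm_eq_0_imp_AE:
  assumes "f \<in> car (pre_Lp M p)" "vnorm (pre_Lp M p) f \<le> 0"
  shows "AE x in M. f x = 0"
proof -
  have f: "if p = \<infinity> then AE x in M. cmod (f x) \<le> 0
      else (\<integral>\<^sup>+x. ennreal (cmod (f x) powr r) \<partial>M) \<le> ennreal (0 powr r)"
    using norm_le_iff[OF order.refl, of f] assms by blast
  note [measurable] = car_measurable[OF assms(1)]
  show ?thesis
  proof (cases "p = \<infinity>")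
    case False
    with f have "(\<integral>\<^sup>+x. ennreal (cmod (f x) powr r) \<partial>M) = 0" by simp
    then show ?thesis by (simp add: nn_integral_0_iff_AE)
  qed (use f in simp)
qed

lemma bounded_in_car:
  assumes "f \<in> borel_measurable M" "\<And>x. x \<in> space M \<Longrightarrow> cmod (f x) \<le> K"
  shows "f \<in> car (pre_Lp M p)"
proof (cases "p = \<infinity>")
  case True
  then show ?thesis using norm_le_iff[of "max K 0" f] assms by (simp add: max.coboundedI1)
next
  case False
  have "integrable M (\<lambda>x. cmod (f x) powr r)"
    using assms r_ge_1[OF False] by (intro integrable_const_bound[of _ "K powr r"]) (auto intro!: powr_mono2)
  with False assms(1) show ?thesis by (simp add: pre_Lp_def)
qed

lemma bounded_mult_in_car:
  assumes "b \<in> borel_measurable M" "\<And>x. x \<in> space M \<Longrightarrow> cmod (b x) \<le> K" "f \<in> car (pre_Lp M p)"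
  shows "(\<lambda>x. b x * f x) \<in> car (pre_Lp M p)"
proof (cases "p = \<infinity>")
  case True
  have f: "AE x in M. cmod (f x) \<le> vnorm (pre_Lp M p) f"
    using norm_bound_self[OF assms(3)] True by simp
  have "AE x in M. cmod (b x * f x) \<le> max K 0 * vnorm (pre_Lp M p) f"
  proof (rule AE_mp[OF f], intro AE_I2 impI)
    fix x assume "x \<in> space M" "cmod (f x) \<le> vnorm (pre_Lp M p) f"
    then show "cmod (b x * f x) \<le> max K 0 * vnorm (pre_Lp M p) f"
      unfolding norm_mult using assms(2) by (intro mult_mono) (auto intro: max.coboundedI1)
  qed
  then show ?thesis
    using norm_le_iff[OF mult_nonneg_nonneg[OF max.cobounded2 norm_ge_0], of "\<lambda>x. b x * f x" K f]
      True assms(1) car_measurable[OF assms(3)] by simp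
next
  case False
  note [measurable] = assms(1) car_measurable[OF assms(3)]
  have "integrable M (\<lambda>x. K powr r * cmod (f x) powr r)"
    using assms(3) False by (simp add: pre_Lp_def)
  then have "integrable M (\<lambda>x. cmod (b x * f x) powr r)"
  proof (rule Bochner_Integration.integrable_bound)
    show "AE x in M. norm (cmod (b x * f x) powr r) \<le> norm (K powr r * cmod (f x) powr r)"
    proof (rule AE_I2)
      fix x assume "x \<in> space M"
      then have "cmod (b x) powr r \<le> K powr r" using assms(2) r_ge_1[OF False] by (intro powr_mono2) auto
      then show "norm (cmod (b x * f x) powr r) \<le> norm (K powr r * cmod (f x) powr r)"
        by (simp add: norm_mult powr_mult mult_right_mono)
    qed
  qed simp
  with False show ?thesis by (simp add: pre_Lp_def)
qed

lemma add_in_car: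
  assumes "f \<in> car (pre_Lp M p)" "g \<in> car (pre_Lp M p)"
  shows "(\<lambda>x. f x + g x) \<in> car (pre_Lp M p)"
proof -
  note [measurable] = car_measurable[OF assms(1)] car_measurable[OF assms(2)]
  show ?thesis
  proof (cases "p = \<infinity>")
    case True
    have "AE x in M. cmod (f x) \<le> vnorm (pre_Lp M p) f" "AE x in M. cmod (g x) \<le> vnorm (pre_Lp M p) g"
      using norm_bound_self[OF assms(1)] norm_bound_self[OF assms(2)] True by simp_all
    then have "AE x in M. cmod (f x + g x) \<le> vnorm (pre_Lp M p) f + vnorm (pre_Lp M p) g"
      by eventually_elim (meson add_mono norm_triangle_ineq order_trans)
    then show ?thesis
      using norm_le_iff[OF add_nonneg_nonneg[OF norm_ge_0 norm_ge_0], of "\<lambda>x. f x + g x" f g] True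
      by simp
  next
    case False
    note r = r_ge_1[OF False]
    have "integrable M (\<lambda>x. 2 powr r * (cmod (f x) powr r + cmod (g x) powr r))"
      using assms False by (auto simp: pre_Lp_def)
    then have "integrable M (\<lambda>x. cmod (f x + g x) powr r)"
    proof (rule Bochner_Integration.integrable_bound)
      show "AE x in M. norm (cmod (f x + g x) powr r) \<le> norm (2 powr r * (cmod (f x) powr r + cmod (g x) powr r))"
      proof (rule AE_I2)
        fix x
        let ?m = "max (cmod (f x)) (cmod (g x))"
        have "cmod (f x + g x) \<le> 2 * ?m" by (rule order_trans[OF norm_triangle_ineq]) auto
        then have "cmod (f x + g x) powr r \<le> (2 * ?m) powr r" using r by (intro powr_mono2) auto
        also have "\<dots> = 2 powr r * ?m powr r" by (simp add: powr_mult)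
        also have "\<dots> \<le> 2 powr r * (cmod (f x) powr r + cmod (g x) powr r)"
          by (intro mult_left_mono) (auto simp: max_def)
        finally show "norm (cmod (f x + g x) powr r) \<le> norm (2 powr r * (cmod (f x) powr r + cmod (g x) powr r))"
          by simp
      qed
    qed simp
    with False show ?thesis by (simp add: pre_Lp_def)
  qed
qed

text \<open>At each point the truncations increase in modulus and are eventually equal to f. For finite p the
  claim is monotone convergence; for infinite p it holds because countably many null sets have a
  null union.\<close>

lemma norm_le_of_truncations:
  assumes [measurable]: "f \<in> borel_measurable M" and "0 \<le> C"
    and trunc: "\<And>n::nat. (\<lambda>x. indicator {x\<in>space M. cmod (f x) \<le> n} x * f x) \<in> car (pre_Lp M p)
      \<and> vnorm (pre_Lp M p) (\<lambda>x. indicator {x\<in>space M. cmod (f x) \<le> n} x * f x) \<le> C"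
  shows "f \<in> car (pre_Lp M p) \<and> vnorm (pre_Lp M p) f \<le> C"
proof -
  define t where "t n x = indicator {x\<in>space M. cmod (f x) \<le> real n} x * f x" for n x
  have t: "if p = \<infinity> then AE x in M. cmod (t n x) \<le> C
      else (\<integral>\<^sup>+x. ennreal (cmod (t n x) powr r) \<partial>M) \<le> ennreal (C powr r)" for n
    using norm_le_iff[OF assms(2), of "t n"] trunc[of n] unfolding t_def[abs_def] by blast
  have [measurable]: "t n \<in> borel_measurable M" for n by (simp add: t_def[abs_def])
  have limit: "\<exists>n. t n x = f x" if "x \<in> space M" for x
  proof -
    obtain n where "cmod (f x) \<le> real n" using real_arch_simple by blast
    with that show ?thesis by (intro exI[of _ n]) (simp add: t_def)
  qed
  have mono: "cmod (t m x) \<le> cmod (t n x)" if "m \<le> n" for m n x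
    using that by (auto simp: t_def indicator_def)
  have le: "cmod (t n x) \<le> cmod (f x)" for n x by (auto simp: t_def indicator_def)
  show ?thesis
    unfolding norm_le_iff[OF assms(2)]
  proof (intro conjI assms(1))
    show "if p = \<infinity> then AE x in M. cmod (f x) \<le> C
        else (\<integral>\<^sup>+x. ennreal (cmod (f x) powr r) \<partial>M) \<le> ennreal (C powr r)"
    proof (cases "p = \<infinity>")
      case True
      then have "AE x in M. \<forall>n. cmod (t n x) \<le> C" using t by (simp add: AE_all_countable)
      then have "AE x in M. cmod (f x) \<le> C"
      proof (rule AE_mp, intro AE_I2 impI)
        fix x assume "x \<in> space M" and C: "\<forall>n. cmod (t n x) \<le> C"
        then obtain n where "t n x = f x" using limit by blast
        with C show "cmod (f x) \<le> C" by metis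
      qed
      with True show ?thesis by simp
    next
      case False
      note r = r_ge_1[OF False]
      have "(\<integral>\<^sup>+x. ennreal (cmod (f x) powr r) \<partial>M) = (\<integral>\<^sup>+x. (SUP n. ennreal (cmod (t n x) powr r)) \<partial>M)"
      proof (rule nn_integral_cong)
        fix x assume "x \<in> space M"
        then obtain n where n: "t n x = f x" using limit by blast
        show "ennreal (cmod (f x) powr r) = (SUP n. ennreal (cmod (t n x) powr r))"
        proof (rule antisym)
          show "ennreal (cmod (f x) powr r) \<le> (SUP n. ennreal (cmod (t n x) powr r))"
            unfolding n[symmetric] by (rule SUP_upper) simp
          show "(SUP n. ennreal (cmod (t n x) powr r)) \<le> ennreal (cmod (f x) powr r)"
            using r by (intro SUP_least ennreal_leI powr_mono2 le) auto
        qed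
      qed
      also have "\<dots> = (SUP n. \<integral>\<^sup>+x. ennreal (cmod (t n x) powr r) \<partial>M)"
        using r by (intro nn_integral_monotone_convergence_SUP)
          (auto simp: incseq_def le_fun_def intro!: ennreal_leI powr_mono2 mono)
      also have "\<dots> \<le> ennreal (C powr r)" using t False by (intro SUP_least) simp
      finally show ?thesis using False by simp
    qed
  qed
qed

lemma vspace_pre_Lp: "vspace (pre_Lp M p)"
proof unfold_locales
  show "vzero (pre_Lp M p) \<in> car (pre_Lp M p)"
    unfolding pre_Lp_simps by (rule bounded_in_car[of _ 0]) auto
  show "vscale (pre_Lp M p) c f \<in> car (pre_Lp M p)" if "f \<in> car (pre_Lp M p)" for c f
    unfolding pre_Lp_simps by (rule bounded_mult_in_car[OF _ _ that]) auto
qed (auto simp: pre_Lp_simps add_in_car algebra_simps)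

lemma quotient_ae_null: "quotient (pre_Lp M p) (ae_null M p)"
proof -
  interpret vspace "pre_Lp M p" by (rule vspace_pre_Lp)
  show ?thesis
    using zero_in add_in scale_in
    by unfold_locales (auto simp: lin_subspace_def ae_null_def pre_Lp_simps)
qed

end

sublocale Lp_space \<subseteq> quotient "pre_Lp M p" "ae_null M p"
  by (rule quotient_ae_null)

abbreviation Lp_class :: "'a measure \<Rightarrow> ennreal \<Rightarrow> ('a \<Rightarrow> complex) \<Rightarrow> ('a \<Rightarrow> complex) set"
  where "Lp_class M p \<equiv> vcoset (pre_Lp M p) (ae_null M p)"

lemma Lp_of_measure_simps:
  "car (Lp_of_measure M p) = car (quot_space (pre_Lp M p) (ae_null M p))"
  "vadd (Lp_of_measure M p) = vadd (quot_space (pre_Lp M p) (ae_null M p))"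
  "vscale (Lp_of_measure M p) = vscale (quot_space (pre_Lp M p) (ae_null M p))"
  "vnorm (Lp_of_measure M p) = vnorm (quot_space (pre_Lp M p) (ae_null M p))"
  "act (Lp_of_measure M p) b A = (\<Union>f\<in>A. Lp_class M p (\<lambda>x. b x * f x))"
  by (simp_all add: Lp_of_measure_def nspace.extend_def bmodule.fields_def)

lemma linear_operator_Lp_of_measure:
  "linear_operator (Lp_of_measure M p) (Lp_of_measure N q)
    = linear_operator (quot_space (pre_Lp M p) (ae_null M p)) (quot_space (pre_Lp N q) (ae_null N q))"
  by (simp add: fun_eq_iff linear_operator_def Lp_of_measure_simps)

lemma bounded_measurable_iff:
  "b \<in> bounded_measurable (space M) (sets M) \<longleftrightarrow>
    b \<in> borel_measurable M \<and> (\<exists>K. \<forall>x\<in>space M. cmod (b x) \<le> K) \<and> (\<forall>x. x \<notin> space M \<longrightarrow> b x = 0)"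
proof -
  have "sets (sigma (space M) (sets M)) = sets M" by simp
  then have "borel_measurable (sigma (space M) (sets M)) = borel_measurable M"
    by (rule measurable_cong_sets) simp
  then show ?thesis by (auto simp: bounded_measurable_def bounded_iff)
qed

context Lp_space
begin

lemma Lp_carE:
  assumes "A \<in> car (Lp_of_measure M p)"
  obtains f where "f \<in> car (pre_Lp M p)" "A = Lp_class M p f"
  using assms quot_carE by (auto simp: Lp_of_measure_simps)

lemma Lp_class_in: "f \<in> car (pre_Lp M p) \<Longrightarrow> Lp_class M p f \<in> car (Lp_of_measure M p)"
  by (simp add: Lp_of_measure_simps coset_in)

lemma Lp_class_eq_iff:
  assumes "f \<in> car (pre_Lp M p)" "g \<in> car (pre_Lp M p)"
  shows "Lp_class M p f = Lp_class M p g \<longleftrightarrow> (AE x in M. f x = g x)"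
proof -
  have "vminus (pre_Lp M p) f g \<in> car (pre_Lp M p)" by (rule minus_in[OF assms])
  then show ?thesis
    using coset_eq_iff[OF assms] by (simp add: ae_null_def pre_Lp_simps)
qed

lemma Lp_class_mem_iff:
  assumes "f \<in> car (pre_Lp M p)"
  shows "g \<in> Lp_class M p f \<longleftrightarrow> g \<in> car (pre_Lp M p) \<and> (AE x in M. g x = f x)"
  using coset_mem_iff[OF assms, of g] minus_in[OF _ assms, of g]
  by (auto simp: pre_Lp_simps ae_null_def)

lemma Lp_norm_class:
  assumes "f \<in> car (pre_Lp M p)"
  shows "vnorm (Lp_of_measure M p) (Lp_class M p f) = vnorm (pre_Lp M p) f"
  unfolding Lp_of_measure_simps
proof (rule antisym)
  show "vnorm (quot_space (pre_Lp M p) (ae_null M p)) (Lp_class M p f) \<le> vnorm (pre_Lp M p) f"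
    by (rule quot_norm_le[OF norm_ge_0 assms coset_self[OF assms]])
  show "vnorm (pre_Lp M p) f \<le> vnorm (quot_space (pre_Lp M p) (ae_null M p)) (Lp_class M p f)"
  proof (rule quot_norm_greatest[OF assms])
    fix g assume "g \<in> Lp_class M p f"
    then have g: "g \<in> car (pre_Lp M p)" "AE x in M. g x = f x"
      using assms by (auto simp: Lp_class_mem_iff)
    then show "vnorm (pre_Lp M p) f \<le> vnorm (pre_Lp M p) g"
      using norm_AE_cong(2)[OF assms car_measurable[OF g(1)]] by simp
  qed
qed

lemma bounded_measurable_mult_in:
  "\<lbrakk>b \<in> bounded_measurable (space M) (sets M); f \<in> car (pre_Lp M p)\<rbrakk> \<Longrightarrow> (\<lambda>x. b x * f x) \<in> car (pre_Lp M p)"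
  by (auto simp: bounded_measurable_iff intro: bounded_mult_in_car)

lemma Lp_act_class:
  assumes b: "b \<in> bounded_measurable (space M) (sets M)" and f: "f \<in> car (pre_Lp M p)"
  shows "act (Lp_of_measure M p) b (Lp_class M p f) = Lp_class M p (\<lambda>x. b x * f x)"
proof -
  have "Lp_class M p (\<lambda>x. b x * g x) = Lp_class M p (\<lambda>x. b x * f x)" if "g \<in> Lp_class M p f" for g
  proof -
    have g: "g \<in> car (pre_Lp M p)" "AE x in M. g x = f x"
      using that f by (auto simp: Lp_class_mem_iff)
    then show ?thesis
      using b f by (subst Lp_class_eq_iff) (auto intro: bounded_measurable_mult_in)
  qed
  then have "act (Lp_of_measure M p) b (Lp_class M p f) = (\<Union>g\<in>Lp_class M p f. Lp_class M p (\<lambda>x. b x * f x))"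
    unfolding Lp_of_measure_simps by (simp cong: SUP_cong)
  with f show ?thesis by (simp add: coset_nonempty)
qed

lemma Lp_prenormed_module: "prenormed_module (bounded_measurable (space M) (sets M)) (Lp_of_measure M p)"
proof unfold_locales
  interpret Q: vspace "quot_space (pre_Lp M p) (ae_null M p)" by (rule vspace_quot)
  fix x y c assume x: "x \<in> car (Lp_of_measure M p)"
  show "y \<in> car (Lp_of_measure M p) \<Longrightarrow> vadd (Lp_of_measure M p) x y \<in> car (Lp_of_measure M p)"
    using x Q.add_in by (simp add: Lp_of_measure_simps)
  show "vscale (Lp_of_measure M p) c x \<in> car (Lp_of_measure M p)"
    using x Q.scale_in by (simp add: Lp_of_measure_simps)
  show "0 \<le> vnorm (Lp_of_measure M p) x"
    using x by (auto elim!: Lp_carE simp: Lp_norm_class norm_ge_0)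
next
  fix b x assume "b \<in> bounded_measurable (space M) (sets M)" "x \<in> car (Lp_of_measure M p)"
  then show "act (Lp_of_measure M p) b x \<in> car (Lp_of_measure M p)"
    by (auto elim!: Lp_carE simp: Lp_act_class Lp_class_in bounded_measurable_mult_in)
qed

end

section \<open>Admissible monomorphisms have left inverses\<close>

text \<open>For a bounded function f the module property gives i(f) = f i(1). A general function is bounded on
  each member of a sequence of sets that exhausts the space, and the indicators of these sets belong
  to the algebra.\<close>

lemma Lp_morphism_is_multiplication:
  assumes "Lp_space M p" "Lp_space N q" and same: "sets M = sets N"
    and i: "module_map (bounded_measurable (space M) (sets M)) (Lp_of_measure M p) (Lp_of_measure N q) i"
  obtains g where "g \<in> car (pre_Lp N q)"
    "\<And>f. f \<in> car (pre_Lp M p) \<Longrightarrow>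
      (\<lambda>x. f x * g x) \<in> car (pre_Lp N q) \<and> i (Lp_class M p f) = Lp_class N q (\<lambda>x. f x * g x)"
proof -
  interpret M: Lp_space M p by fact
  interpret N: Lp_space N q by fact
  have space: "space M = space N" using same by (rule sets_eq_imp_space_eq)
  have meas: "borel_measurable M = (borel_measurable N :: ('a \<Rightarrow> complex) set)"
    using same by (rule measurable_cong_sets) simp
  let ?B = "bounded_measurable (space M) (sets M)"
  have B: "?B = bounded_measurable (space N) (sets N)" by (simp add: space same)
  have i_in: "i A \<in> car (Lp_of_measure N q)" if "A \<in> car (Lp_of_measure M p)" for A
    using i that by (auto simp: module_map_def bounded_operator_def linear_operator_def)
  have i_act: "i (act (Lp_of_measure M p) b A) = act (Lp_of_measure N q) b (i A)"
    if "b \<in> ?B" "A \<in> car (Lp_of_measure M p)" for b A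
    using i that by (auto simp: module_map_def)
  have one: "(\<lambda>_. 1) \<in> car (pre_Lp M p)" by (rule M.bounded_in_car[of _ 1]) auto
  obtain g where g: "g \<in> car (pre_Lp N q)" "i (Lp_class M p (\<lambda>_. 1)) = Lp_class N q g"
    using i_in[OF M.Lp_class_in[OF one]] by (rule N.Lp_carE)
  have bounded: "i (Lp_class M p b) = Lp_class N q (\<lambda>x. b x * g x)" if "b \<in> ?B" for b
  proof -
    have "i (Lp_class M p b) = i (act (Lp_of_measure M p) b (Lp_class M p (\<lambda>_. 1)))"
      using M.Lp_act_class[OF that one] by simp
    also have "\<dots> = act (Lp_of_measure N q) b (Lp_class N q g)"
      using i_act[OF that M.Lp_class_in[OF one]] g(2) by simp
    also have "\<dots> = Lp_class N q (\<lambda>x. b x * g x)"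
      using that g(1) unfolding B by (rule N.Lp_act_class)
    finally show ?thesis .
  qed
  have "(\<lambda>x. f x * g x) \<in> car (pre_Lp N q) \<and> i (Lp_class M p f) = Lp_class N q (\<lambda>x. f x * g x)"
    if f: "f \<in> car (pre_Lp M p)" for f
  proof -
    note [measurable] = M.car_measurable[OF f]
    obtain k where k: "k \<in> car (pre_Lp N q)" "i (Lp_class M p f) = Lp_class N q k"
      using i_in[OF M.Lp_class_in[OF f]] by (rule N.Lp_carE)
    define e :: "nat \<Rightarrow> 'a \<Rightarrow> complex" where "e n = indicator {x\<in>space M. cmod (f x) \<le> n}" for n
    have e: "e n \<in> ?B" for n
      by (auto simp: bounded_measurable_iff e_def indicator_def intro!: exI[of _ 1])
    have ef: "(\<lambda>x. e n x * f x) \<in> ?B" for n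
      by (auto simp: bounded_measurable_iff e_def indicator_def intro!: exI[of _ "real n"])
    have "AE x in N. e n x * k x = e n x * f x * g x" for n
    proof -
      have "Lp_class N q (\<lambda>x. e n x * k x) = act (Lp_of_measure N q) (e n) (i (Lp_class M p f))"
        using N.Lp_act_class[of "e n" k] e[of n] k unfolding B by simp
      also have "\<dots> = i (Lp_class M p (\<lambda>x. e n x * f x))"
        using i_act[OF e[of n] M.Lp_class_in[OF f]] M.Lp_act_class[OF e[of n] f] by simp
      also have "\<dots> = Lp_class N q (\<lambda>x. e n x * f x * g x)" by (rule bounded[OF ef])
      finally show ?thesis
        using N.bounded_measurable_mult_in[of "e n" k] N.bounded_measurable_mult_in[of "\<lambda>x. e n x * f x" g]
          e[of n] ef[of n] k(1) g(1) unfolding B by (simp add: N.Lp_class_eq_iff)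
    qed
    then have "AE x in N. \<forall>n. e n x * k x = e n x * f x * g x"
      unfolding AE_all_countable by blast
    then have eq: "AE x in N. f x * g x = k x"
    proof (rule AE_mp, intro AE_I2 impI)
      fix x assume x: "x \<in> space N" and *: "\<forall>n. e n x * k x = e n x * f x * g x"
      obtain n where "cmod (f x) \<le> real n" using real_arch_simple by blast
      with x have "e n x = 1" by (simp add: e_def space)
      with * show "f x * g x = k x" by (metis mult_1)
    qed
    have "(\<lambda>x. f x * g x) \<in> borel_measurable N"
      using M.car_measurable[OF f] N.car_measurable[OF g(1)] unfolding meas by simp
    from N.norm_AE_cong(1)[OF k(1) this eq] eq show ?thesis
      using k by (simp add: N.Lp_class_eq_iff AE_symmetric)
  qed
  with g(1) show thesis by (rule that)
qed

text \<open>Let i be multiplication by g, and let f be a truncation of h/g. As f g is dominated by h, the norm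
  of f is at most 1/c times that of h, and in the limit h/g has the same bound. Division by g is
  thus bounded. It inverts i because the zeros of g form a null set for the source: their indicator
  is annihilated by i.\<close>

lemma Lp_morphism_left_inverse:
  assumes "Lp_space M p" "Lp_space N q" and same: "sets M = sets N"
    and i: "module_map (bounded_measurable (space M) (sets M)) (Lp_of_measure M p) (Lp_of_measure N q) i"
    and c: "0 < c"
    and below: "\<And>A. A \<in> car (Lp_of_measure M p) \<Longrightarrow>
      c * vnorm (Lp_of_measure M p) A \<le> vnorm (Lp_of_measure N q) (i A)"
  obtains j where
    "module_map (bounded_measurable (space M) (sets M)) (Lp_of_measure N q) (Lp_of_measure M p) j"
    "operator_bounded_by (1 / c) (Lp_of_measure N q) (Lp_of_measure M p) j"
    "\<And>A. A \<in> car (Lp_of_measure M p) \<Longrightarrow> j (i A) = A"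
proof -
  interpret M: Lp_space M p by fact
  interpret N: Lp_space N q by fact
  have space: "space M = space N" using same by (rule sets_eq_imp_space_eq)
  have meas: "borel_measurable M = (borel_measurable N :: ('a \<Rightarrow> complex) set)"
    using same by (rule measurable_cong_sets) simp
  let ?B = "bounded_measurable (space M) (sets M)"
  have B: "?B = bounded_measurable (space N) (sets N)" by (simp add: space same)
  obtain g where g: "g \<in> car (pre_Lp N q)" and mult: "\<And>f. f \<in> car (pre_Lp M p) \<Longrightarrow>
      (\<lambda>x. f x * g x) \<in> car (pre_Lp N q) \<and> i (Lp_class M p f) = Lp_class N q (\<lambda>x. f x * g x)"
    using Lp_morphism_is_multiplication[OF assms(1-4)] by blast
  have gM [measurable]: "g \<in> borel_measurable M" using N.car_measurable[OF g] by (simp add: meas)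
  have below': "c * vnorm (pre_Lp M p) f \<le> vnorm (pre_Lp N q) (\<lambda>x. f x * g x)"
    if "f \<in> car (pre_Lp M p)" for f
    using below[OF M.Lp_class_in[OF that]] mult[OF that] that
    by (simp add: M.Lp_norm_class N.Lp_norm_class)
  \<comment> \<open>The convention h/0 = 0 makes the quotient vanish on the zeros of g.\<close>
  have quotient: "(\<lambda>x. h x / g x) \<in> car (pre_Lp M p)
      \<and> vnorm (pre_Lp M p) (\<lambda>x. h x / g x) \<le> 1 / c * vnorm (pre_Lp N q) h"
    if h: "h \<in> car (pre_Lp N q)" for h
  proof (rule M.norm_le_of_truncations)
    have [measurable]: "h \<in> borel_measurable M" using N.car_measurable[OF h] by (simp add: meas)
    show "(\<lambda>x. h x / g x) \<in> borel_measurable M" by simp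
    show "0 \<le> 1 / c * vnorm (pre_Lp N q) h" using c by (simp add: N.norm_ge_0)
    fix n :: nat
    let ?t = "\<lambda>x. indicator {x\<in>space M. cmod (h x / g x) \<le> n} x * (h x / g x)"
    have t_meas: "?t \<in> borel_measurable M" by simp
    have t: "?t \<in> car (pre_Lp M p)"
      by (rule M.bounded_in_car[OF t_meas, of "real n"]) (auto simp: indicator_def)
    have "vnorm (pre_Lp N q) (\<lambda>x. ?t x * g x) \<le> vnorm (pre_Lp N q) h"
      using mult[OF t] N.car_measurable by (intro N.norm_dominated(2)[OF h]) (auto simp: indicator_def)
    with below'[OF t] have "c * vnorm (pre_Lp M p) ?t \<le> vnorm (pre_Lp N q) h" by simp
    with c t show "?t \<in> car (pre_Lp M p) \<and> vnorm (pre_Lp M p) ?t \<le> 1 / c * vnorm (pre_Lp N q) h"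
      by (simp add: field_simps)
  qed
  let ?d = "\<lambda>h x. h x / g x"
  interpret division: quotient_map "pre_Lp N q" "ae_null N q" "pre_Lp M p" "ae_null M p" ?d
  proof unfold_locales
    show "linear_operator (pre_Lp N q) (pre_Lp M p) ?d"
      using quotient by (auto simp: linear_operator_def M.pre_Lp_simps N.pre_Lp_simps add_divide_distrib)
    fix h assume h: "h \<in> ae_null N q"
    then have "h \<in> car (pre_Lp N q)" by (simp add: ae_null_def)
    moreover have "vnorm (pre_Lp N q) h = 0"
      using h N.norm_le_iff[of 0 h] N.norm_ge_0[of h] by (auto simp: ae_null_def pre_Lp_def nn_integral_0_iff_AE)
    ultimately have "?d h \<in> car (pre_Lp M p)" "vnorm (pre_Lp M p) (?d h) \<le> 0"
      using quotient[of h] by auto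
    then show "?d h \<in> ae_null M p" using M.norm_eq_0_imp_AE[of "?d h"] by (simp add: ae_null_def)
  qed
  define j where "j = quot_map (pre_Lp M p) (ae_null M p) ?d"
  have j: "j (Lp_class N q h) = Lp_class M p (?d h)" if "h \<in> car (pre_Lp N q)" for h
    unfolding j_def by (rule division.quot_map_coset[OF that])
  have j_bound: "operator_bounded_by (1 / c) (Lp_of_measure N q) (Lp_of_measure M p) j"
    unfolding operator_bounded_by_def
  proof (intro conjI ballI)
    show "linear_operator (Lp_of_measure N q) (Lp_of_measure M p) j"
      unfolding linear_operator_Lp_of_measure j_def by (rule division.linear_quot_map)
    fix A assume "A \<in> car (Lp_of_measure N q)"
    then show "vnorm (Lp_of_measure M p) (j A) \<le> 1 / c * vnorm (Lp_of_measure N q) A"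
      using quotient by (auto elim!: N.Lp_carE simp: j M.Lp_norm_class N.Lp_norm_class)
  qed
  have j_act: "j (act (Lp_of_measure N q) b A) = act (Lp_of_measure M p) b (j A)"
    if b: "b \<in> ?B" and A: "A \<in> car (Lp_of_measure N q)" for b A
  proof -
    obtain h where h: "h \<in> car (pre_Lp N q)" "A = Lp_class N q h" using A by (rule N.Lp_carE)
    have b': "b \<in> bounded_measurable (space N) (sets N)" using b by (simp add: B)
    have "?d h \<in> car (pre_Lp M p)" using quotient[OF h(1)] by simp
    then show ?thesis
      using h(1) N.bounded_measurable_mult_in[OF b' h(1)]
      unfolding h(2) by (simp add: N.Lp_act_class[OF b'] M.Lp_act_class[OF b] j)
  qed
  have nonzero: "AE x in M. g x \<noteq> 0"
  proof -
    let ?z = "indicator {x\<in>space M. g x = 0} :: 'a \<Rightarrow> complex"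
    have z: "?z \<in> car (pre_Lp M p)"
      by (rule M.bounded_in_car[of _ 1]) (auto simp: indicator_def)
    have zero: "(\<lambda>x. ?z x * g x) = (\<lambda>_. 0)" by (auto simp: indicator_def)
    have "vnorm (pre_Lp N q) (\<lambda>_. 0) \<le> 0"
      using N.norm_le_iff[of 0 "\<lambda>_. 0"] by (cases "q = \<infinity>") simp_all
    with below'[OF z] have "c * vnorm (pre_Lp M p) ?z \<le> 0" unfolding zero by (rule order_trans)
    with c have "vnorm (pre_Lp M p) ?z \<le> 0" by (simp add: mult_le_0_iff)
    from M.norm_eq_0_imp_AE[OF z this] have "AE x in M. ?z x = 0" .
    then show ?thesis
      by (rule AE_mp) (auto simp: indicator_def)
  qed
  have left_inverse: "j (i A) = A" if A: "A \<in> car (Lp_of_measure M p)" for A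
  proof -
    obtain f where f: "f \<in> car (pre_Lp M p)" "A = Lp_class M p f" using A by (rule M.Lp_carE)
    have fg: "(\<lambda>x. f x * g x) \<in> car (pre_Lp N q)" "i A = Lp_class N q (\<lambda>x. f x * g x)"
      using mult[OF f(1)] f(2) by auto
    have "AE x in M. f x * g x / g x = f x" using nonzero by (rule AE_mp) auto
    then show ?thesis
      using fg f quotient[OF fg(1)] by (simp add: j M.Lp_class_eq_iff)
  qed
  show thesis
    using that j_bound j_act left_inverse operator_bounded_by_imp_bounded[OF j_bound]
    by (auto simp: module_map_def)
qed

section \<open>The variation of a complex measure is finite\<close>

text \<open>Each of the four sums of the positive and negative parts of the real and imaginary parts
  is attained by a subfamily, and one of them is at least a quarter of the sum of the moduli.\<close>

lemma large_subsum:
  fixes z :: "'i \<Rightarrow> complex"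
  assumes "finite I"
  obtains J where "J \<subseteq> I" "(\<Sum>i\<in>I. cmod (z i)) \<le> 4 * cmod (\<Sum>i\<in>J. z i)"
proof -
  define part where "part h = {i\<in>I. 0 \<le> h (z i)}" for h :: "complex \<Rightarrow> real"
  let ?S = "\<Sum>i\<in>I. cmod (z i)"
  have parts: "(\<Sum>i\<in>I. \<bar>h (z i)\<bar>) \<le> \<bar>\<Sum>i\<in>part h. h (z i)\<bar> + \<bar>\<Sum>i\<in>part (\<lambda>w. - h w). h (z i)\<bar>" for h
  proof -
    have "(\<Sum>i\<in>I. \<bar>h (z i)\<bar>) = (\<Sum>i\<in>I. (if 0 \<le> h (z i) then h (z i) else 0)
        + (if 0 \<le> - h (z i) then - h (z i) else 0))"
      by (intro sum.cong) auto
    also have "\<dots> = (\<Sum>i\<in>part h. h (z i)) + (\<Sum>i\<in>part (\<lambda>w. - h w). - h (z i))"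
      using assms by (simp only: sum.distrib part_def sum.inter_filter)
    also have "\<dots> \<le> \<bar>\<Sum>i\<in>part h. h (z i)\<bar> + \<bar>\<Sum>i\<in>part (\<lambda>w. - h w). h (z i)\<bar>"
      by (simp add: sum_negf)
    finally show ?thesis .
  qed
  have re: "\<bar>\<Sum>i\<in>J. Re (z i)\<bar> \<le> cmod (\<Sum>i\<in>J. z i)" for J
    using abs_Re_le_cmod[of "\<Sum>i\<in>J. z i"] by simp
  have im: "\<bar>\<Sum>i\<in>J. Im (z i)\<bar> \<le> cmod (\<Sum>i\<in>J. z i)" for J
    using abs_Im_le_cmod[of "\<Sum>i\<in>J. z i"] by simp
  have "?S \<le> (\<Sum>i\<in>I. \<bar>Re (z i)\<bar> + \<bar>Im (z i)\<bar>)" by (intro sum_mono cmod_le)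
  also have "\<dots> = (\<Sum>i\<in>I. \<bar>Re (z i)\<bar>) + (\<Sum>i\<in>I. \<bar>Im (z i)\<bar>)" by (rule sum.distrib)
  finally have "?S \<le> cmod (\<Sum>i\<in>part Re. z i) + cmod (\<Sum>i\<in>part (\<lambda>w. - Re w). z i)
      + cmod (\<Sum>i\<in>part Im. z i) + cmod (\<Sum>i\<in>part (\<lambda>w. - Im w). z i)"
    using parts[of Re] parts[of Im] re[of "part Re"] re[of "part (\<lambda>w. - Re w)"]
      im[of "part Im"] im[of "part (\<lambda>w. - Im w)"] by linarith
  then consider "?S \<le> 4 * cmod (\<Sum>i\<in>part Re. z i)" | "?S \<le> 4 * cmod (\<Sum>i\<in>part (\<lambda>w. - Re w). z i)"
    | "?S \<le> 4 * cmod (\<Sum>i\<in>part Im. z i)" | "?S \<le> 4 * cmod (\<Sum>i\<in>part (\<lambda>w. - Im w). z i)"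
    by linarith
  moreover have "part h \<subseteq> I" for h by (auto simp: part_def)
  ultimately show thesis using that by cases blast+
qed

lemma complex_measure_sums:
  assumes "\<mu> \<in> complex_measures \<Omega> \<Sigma>" "range A \<subseteq> \<Sigma>" "disjoint_family A"
  shows "(\<lambda>n::nat. \<mu> (A n)) sums \<mu> (\<Union>n. A n)"
  using assms by (simp add: complex_measures_def)

lemma complex_measure_finite_Union:
  assumes "\<mu> \<in> complex_measures \<Omega> \<Sigma>" "{} \<in> \<Sigma>" "range A \<subseteq> \<Sigma>" "disjoint_family A"
    and J: "finite (J :: nat set)"
  shows "\<mu> (\<Union>j\<in>J. A j) = (\<Sum>j\<in>J. \<mu> (A j))"
proof -
  let ?A = "\<lambda>n. if n \<in> J then A n else {}"
  have "range ?A \<subseteq> \<Sigma>" "disjoint_family ?A"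
    using assms by (auto simp: disjoint_family_on_def)
  then have "(\<lambda>n. \<mu> (?A n)) sums \<mu> (\<Union>n. ?A n)"
    by (rule complex_measure_sums[OF assms(1)])
  moreover have "(\<lambda>n. \<mu> (?A n)) sums (\<Sum>n\<in>J. \<mu> (?A n))"
    using assms(1) by (intro sums_finite J) (auto simp: complex_measures_def)
  moreover have "(\<Union>n. ?A n) = (\<Union>j\<in>J. A j)" by (auto split: if_splits)
  ultimately show ?thesis using sums_unique2 by fastforce
qed

lemma complex_measure_Un:
  assumes "\<mu> \<in> complex_measures \<Omega> \<Sigma>" "{} \<in> \<Sigma>" "A \<in> \<Sigma>" "B \<in> \<Sigma>" "A \<inter> B = {}"
  shows "\<mu> (A \<union> B) = \<mu> A + \<mu> B"
proof -
  let ?F = "\<lambda>n::nat. if n = 0 then A else if n = 1 then B else {}"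
  have "range ?F \<subseteq> \<Sigma>" "disjoint_family ?F"
    using assms by (auto simp: disjoint_family_on_def)
  from complex_measure_finite_Union[OF assms(1,2) this, of "{0, 1}"]
  show ?thesis by (simp add: Un_commute)
qed

text \<open>A partition with a large sum of moduli yields a subset whose measure exceeds that of E by more
  than 2 in modulus. The measure of its complement in E is then large as well.\<close>

lemma infinite_variation_split:
  assumes "sigma_algebra \<Omega> \<Sigma>" and \<mu>: "\<mu> \<in> complex_measures \<Omega> \<Sigma>"
    and E: "E \<in> \<Sigma>" "variation \<Sigma> \<mu> E = \<infinity>"
  obtains A where "A \<in> \<Sigma>" "A \<subseteq> E" "1 < cmod (\<mu> A)" "1 < cmod (\<mu> (E - A))"
proof -
  interpret sigma_algebra \<Omega> \<Sigma> by fact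
  \<comment> \<open>The factor 4 is lost in the choice of a subfamily whose sum is large.\<close>
  define t where "t = 4 * (2 + cmod (\<mu> E))"
  have t_nonneg: "0 \<le> t" by (simp add: t_def)
  have "ennreal t < variation \<Sigma> \<mu> E" using E by simp
  then obtain P :: "nat \<Rightarrow> 'a set" where P: "range P \<subseteq> \<Sigma>" "disjoint_family P" "(\<Union>n. P n) = E"
    "ennreal t < suminf (\<lambda>n. ennreal (cmod (\<mu> (P n))))"
    unfolding variation_def less_SUP_iff by blast
  obtain n where "ennreal t < (\<Sum>i<n. ennreal (cmod (\<mu> (P i))))"
    using P(4) unfolding suminf_eq_SUP less_SUP_iff by blast
  then have t: "t < (\<Sum>i<n. cmod (\<mu> (P i)))"
    using t_nonneg by (simp add: sum_nonneg ennreal_less_iff)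
  obtain J where J: "J \<subseteq> {..<n}" "(\<Sum>i<n. cmod (\<mu> (P i))) \<le> 4 * cmod (\<Sum>i\<in>J. \<mu> (P i))"
    by (rule large_subsum[OF finite_lessThan, of n "\<lambda>i. \<mu> (P i)"])
  then have "finite J" using finite_subset by blast
  let ?A = "\<Union>j\<in>J. P j"
  have A: "?A \<in> \<Sigma>" "?A \<subseteq> E" using P \<open>finite J\<close> by auto
  have muA: "\<mu> ?A = (\<Sum>i\<in>J. \<mu> (P i))"
    using complex_measure_finite_Union[OF \<mu> _ P(1,2) \<open>finite J\<close>] by simp
  have "\<mu> E = \<mu> ?A + \<mu> (E - ?A)"
    using complex_measure_Un[OF \<mu> _ A(1), of "E - ?A"] A E Diff[OF E(1) A(1)] by (simp add: Un_absorb1)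
  then have "cmod (\<mu> ?A) \<le> cmod (\<mu> E) + cmod (\<mu> (E - ?A))"
    by (metis add_diff_cancel_right' norm_triangle_ineq4)
  moreover have "2 + cmod (\<mu> E) < cmod (\<mu> ?A)"
    using less_le_trans[OF t J(2)] by (simp add: muA t_def)
  moreover have "0 \<le> cmod (\<mu> E)" by simp
  ultimately have "1 < cmod (\<mu> ?A)" "1 < cmod (\<mu> (E - ?A))" by linarith+
  with A show thesis by (rule that)
qed

lemma variation_measure_space_sets:
  assumes "sigma_algebra \<Omega> \<Sigma>"
  shows "space (variation_measure \<Omega> \<Sigma> \<mu>) = \<Omega>" "sets (variation_measure \<Omega> \<Sigma> \<mu>) = \<Sigma>"
proof -
  interpret sigma_algebra \<Omega> \<Sigma> by fact
  show "space (variation_measure \<Omega> \<Sigma> \<mu>) = \<Omega>" "sets (variation_measure \<Omega> \<Sigma> \<mu>) = \<Sigma>"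
    by (simp_all add: variation_measure_def space_measure_of_conv)
qed

text \<open>If the variation of the whole space were infinite, splitting repeatedly a part of infinite
  variation would give disjoint sets whose measures exceed 1 in modulus, although these measures
  are the terms of a convergent series. One of two parts has infinite variation by additivity: if
  the variation failed to be a measure, \<^const>\<open>measure_of\<close> would return the zero measure, which is
  finite.\<close>

lemma finite_variation_measure:
  assumes "sigma_algebra \<Omega> \<Sigma>" and \<mu>: "\<mu> \<in> complex_measures \<Omega> \<Sigma>"
  shows "finite_measure (variation_measure \<Omega> \<Sigma> \<mu>)"
proof (rule ccontr)
  interpret sigma_algebra \<Omega> \<Sigma> by fact
  let ?V = "variation_measure \<Omega> \<Sigma> \<mu>"
  note sets = variation_measure_space_sets[OF assms(1), of \<mu>]
  assume "\<not> finite_measure ?V"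
  then have inf: "emeasure ?V \<Omega> = \<infinity>"
    using finite_measureI[of ?V] sets by auto
  have ms: "measure_space \<Omega> \<Sigma> (variation \<Sigma> \<mu>)"
  proof (rule ccontr)
    assume "\<not> measure_space \<Omega> \<Sigma> (variation \<Sigma> \<mu>)"
    then have "emeasure ?V \<Omega> = 0"
      by (simp add: variation_measure_def emeasure_measure_of_conv space_closed sigma_sets_eq)
    with inf show False by simp
  qed
  have V: "emeasure ?V E = variation \<Sigma> \<mu> E" if "E \<in> \<Sigma>" for E
    using that ms by (simp add: variation_measure_def emeasure_measure_of_conv space_closed sigma_sets_eq)
  have step: "\<exists>A. A \<in> \<Sigma> \<and> A \<subseteq> E \<and> 1 < cmod (\<mu> (E - A)) \<and> variation \<Sigma> \<mu> A = \<infinity>"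
    if E: "E \<in> \<Sigma>" "variation \<Sigma> \<mu> E = \<infinity>" for E
  proof -
    obtain A where A: "A \<in> \<Sigma>" "A \<subseteq> E" "1 < cmod (\<mu> A)" "1 < cmod (\<mu> (E - A))"
      by (rule infinite_variation_split[OF assms E])
    have D: "E - A \<in> \<Sigma>" using E A by auto
    have "emeasure ?V A + emeasure ?V (E - A) = emeasure ?V (A \<union> (E - A))"
      using A D by (intro plus_emeasure) (auto simp: sets)
    also have "A \<union> (E - A) = E" using A by auto
    finally have "variation \<Sigma> \<mu> A = \<infinity> \<or> variation \<Sigma> \<mu> (E - A) = \<infinity>"
      using E A D by (simp add: V)
    moreover have "E - (E - A) = A" using A by auto
    ultimately show ?thesis using A D by (metis Diff_subset)
  qed
  define good where "good E \<longleftrightarrow> E \<in> \<Sigma> \<and> variation \<Sigma> \<mu> E = \<infinity>" for E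
  have "\<exists>E. \<forall>n. good (E n) \<and> (E (Suc n) \<subseteq> E n \<and> 1 < cmod (\<mu> (E n - E (Suc n))))"
  proof (rule dependent_nat_choice[of "\<lambda>_. good" "\<lambda>_ E A. A \<subseteq> E \<and> 1 < cmod (\<mu> (E - A))"])
    show "\<exists>E. good E" using inf V[OF top] top by (auto simp: good_def)
    show "\<exists>A. good A \<and> (A \<subseteq> E \<and> 1 < cmod (\<mu> (E - A)))" if "good E" for E and n :: nat
      using step[of E] that by (auto simp: good_def)
  qed
  then obtain E where "\<forall>n. good (E n) \<and> (E (Suc n) \<subseteq> E n \<and> 1 < cmod (\<mu> (E n - E (Suc n))))" ..
  then have E: "E n \<in> \<Sigma>" "E (Suc n) \<subseteq> E n" "1 < cmod (\<mu> (E n - E (Suc n)))" for n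
    by (simp_all add: good_def)
  let ?A = "\<lambda>n. E n - E (Suc n)"
  have "?A m \<inter> ?A n = {}" if "m < n" for m n
  proof -
    have "E n \<subseteq> E (Suc m)" using lift_Suc_antimono_le[of E "Suc m" n] E(2) that by auto
    then show ?thesis by blast
  qed
  then have "disjoint_family ?A"
    unfolding disjoint_family_on_def by (metis inf_commute linorder_neqE_nat)
  moreover have "range ?A \<subseteq> \<Sigma>" using E(1) by auto
  ultimately have "(\<lambda>n. \<mu> (?A n)) sums \<mu> (\<Union>n. ?A n)"
    by (intro complex_measure_sums[OF \<mu>])
  then have "(\<lambda>n. \<mu> (?A n)) \<longlonglongrightarrow> 0" by (intro summable_LIMSEQ_zero sums_summable)
  then have "\<forall>\<^sub>F n in sequentially. cmod (\<mu> (?A n)) < 1"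
    by (auto simp: tendsto_iff dist_norm elim: allE[of _ 1])
  then obtain n where "cmod (\<mu> (?A n)) < 1" by (meson eventually_sequentially order.refl)
  with E(3)[of n] show False by simp
qed

section \<open>Flatness\<close>

lemma Lp_modules_cases:
  assumes "sigma_algebra \<Omega> \<Sigma>" "X \<in> Lp_modules \<Omega> \<Sigma>"
  obtains M p where "Lp_space M p" "space M = \<Omega>" "sets M = \<Sigma>" "X = Lp_of_measure M p"
proof -
  obtain p \<mu> where *: "1 \<le> p" "\<mu> \<in> complex_measures \<Omega> \<Sigma>" "X = Lp \<Omega> \<Sigma> p \<mu>"
    using assms(2) by (auto simp: Lp_modules_def)
  have "Lp_space (variation_measure \<Omega> \<Sigma> \<mu>) p"
    by (intro Lp_space.intro Lp_space_axioms.intro finite_variation_measure assms(1) *)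
  then show thesis
    using that variation_measure_space_sets[OF assms(1)] *(3) by (simp add: Lp_def)
qed

lemma Lp_modules_prenormed:
  assumes "sigma_algebra \<Omega> \<Sigma>" "X \<in> Lp_modules \<Omega> \<Sigma>"
  shows "prenormed_module (bounded_measurable \<Omega> \<Sigma>) X"
  using Lp_modules_cases[OF assms] Lp_space.Lp_prenormed_module by metis

text \<open>The left inverse has the bound 1/c, which becomes the lower bound c after tensoring. Because the
  constants do not change, one statement covers topologically injective maps and, with K = c = 1,
  isometric ones.\<close>

lemma tensor_map_keeps_bounds:
  assumes "sigma_algebra \<Omega> \<Sigma>"
    and mods: "X \<in> Lp_modules \<Omega> \<Sigma>" "Y \<in> Lp_modules \<Omega> \<Sigma>" "F \<in> Lp_modules \<Omega> \<Sigma>"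
    and i: "module_map (bounded_measurable \<Omega> \<Sigma>) X Y i" "operator_bounded_by K X Y i" "0 \<le> K"
    and c: "0 < c" "\<And>x. x \<in> car X \<Longrightarrow> c * vnorm X x \<le> vnorm Y (i x)"
  shows "operator_bounded_by K (module_tensor (bounded_measurable \<Omega> \<Sigma>) X F)
      (module_tensor (bounded_measurable \<Omega> \<Sigma>) Y F) (tensor_map (bounded_measurable \<Omega> \<Sigma>) X F Y F i (\<lambda>f. f))"
    and "z \<in> car (module_tensor (bounded_measurable \<Omega> \<Sigma>) X F) \<Longrightarrow>
      c * vnorm (module_tensor (bounded_measurable \<Omega> \<Sigma>) X F) z
      \<le> vnorm (module_tensor (bounded_measurable \<Omega> \<Sigma>) Y F)
        (tensor_map (bounded_measurable \<Omega> \<Sigma>) X F Y F i (\<lambda>f. f) z)"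
proof -
  let ?B = "bounded_measurable \<Omega> \<Sigma>"
  obtain M p where M: "Lp_space M p" "space M = \<Omega>" "sets M = \<Sigma>" "X = Lp_of_measure M p"
    using Lp_modules_cases[OF assms(1) mods(1)] .
  obtain N q where N: "Lp_space N q" "space N = \<Omega>" "sets N = \<Sigma>" "Y = Lp_of_measure N q"
    using Lp_modules_cases[OF assms(1) mods(2)] .
  have same: "sets M = sets N" using M N by simp
  obtain j where j: "module_map ?B Y X j" "operator_bounded_by (1 / c) Y X j"
    "\<And>x. x \<in> car X \<Longrightarrow> j (i x) = x"
    using Lp_morphism_left_inverse[OF M(1) N(1) same, of i c] i(1) c unfolding M(2-4) N(2-4) by blast
  note retract = tensor_map_of_retract[OF mods[THEN Lp_modules_prenormed[OF assms(1)]] i j(1,2) _ j(3)]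
  show "operator_bounded_by K (module_tensor ?B X F) (module_tensor ?B Y F) (tensor_map ?B X F Y F i (\<lambda>f. f))"
    using retract(1) c(1) by simp
  show "c * vnorm (module_tensor ?B X F) z \<le> vnorm (module_tensor ?B Y F) (tensor_map ?B X F Y F i (\<lambda>f. f) z)"
    if "z \<in> car (module_tensor ?B X F)"
    using retract(2)[OF _ _ that] c(1) by (simp add: field_simps)
qed

theorem theorem3p4p2:
  fixes \<Omega> :: "'a set" and \<Sigma> :: "'a set set" and p :: ennreal and \<mu> :: "'a set \<Rightarrow> complex"
  assumes "sigma_algebra \<Omega> \<Sigma>"
    and "1 \<le> p"
    and "\<mu> \<in> complex_measures \<Omega> \<Sigma>"
  shows "relatively_flat (bounded_measurable \<Omega> \<Sigma>) (Lp_modules \<Omega> \<Sigma>) (Lp_modules \<Omega> \<Sigma>) (Lp \<Omega> \<Sigma> p \<mu>)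
    \<and> metrically_flat (bounded_measurable \<Omega> \<Sigma>) (Lp_modules \<Omega> \<Sigma>) (Lp_modules \<Omega> \<Sigma>) (Lp \<Omega> \<Sigma> p \<mu>)
    \<and> extremely_flat (bounded_measurable \<Omega> \<Sigma>) (Lp_modules \<Omega> \<Sigma>) (Lp_modules \<Omega> \<Sigma>) (Lp \<Omega> \<Sigma> p \<mu>)"
proof -
  let ?B = "bounded_measurable \<Omega> \<Sigma>" and ?L = "Lp_modules \<Omega> \<Sigma>" and ?F = "Lp \<Omega> \<Sigma> p \<mu>"
  have F: "?F \<in> ?L" using assms(2,3) by (auto simp: Lp_modules_def)
  have relative: "topologically_injective (module_tensor ?B X ?F) (module_tensor ?B Y ?F)
      (tensor_map ?B X ?F Y ?F i (\<lambda>f. f))"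
    if XY: "X \<in> ?L" "Y \<in> ?L" and i: "module_map ?B X Y i" "topologically_injective X Y i" for X Y i
  proof -
    interpret X: prenormed_module ?B X by (rule Lp_modules_prenormed[OF assms(1) XY(1)])
    obtain K where K: "0 \<le> K" "operator_bounded_by K X Y i"
      using bounded_operator_nonneg_bound[OF _ X.norm_ge_0] i(2)
      unfolding topologically_injective_def by blast
    obtain c where c: "0 < c" "\<And>x. x \<in> car X \<Longrightarrow> c * vnorm X x \<le> vnorm Y (i x)"
      using i(2) unfolding topologically_injective_def by blast
    note bounds = tensor_map_keeps_bounds[OF assms(1) XY F i(1) K(2,1) c]
    show ?thesis
      unfolding topologically_injective_def
      using operator_bounded_by_imp_bounded[OF bounds(1)] bounds(2) c(1) by blast
  qed
  have metric: "isometric_operator (module_tensor ?B X ?F) (module_tensor ?B Y ?F)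
      (tensor_map ?B X ?F Y ?F i (\<lambda>f. f))"
    if XY: "X \<in> ?L" "Y \<in> ?L" and i: "module_map ?B X Y i" "isometric_operator X Y i" for X Y i
  proof -
    have "operator_bounded_by 1 X Y i" "\<And>x. x \<in> car X \<Longrightarrow> 1 * vnorm X x \<le> vnorm Y (i x)"
      using i(2) by (auto simp: isometric_operator_def operator_bounded_by_def)
    note bounds = tensor_map_keeps_bounds[OF assms(1) XY F i(1) this(1) zero_le_one zero_less_one this(2)]
    show ?thesis
      unfolding isometric_operator_def
      using operator_bounded_byD[OF bounds(1)] bounds(2) by (auto intro!: antisym)
  qed
  show ?thesis
    using F relative metric
    unfolding relatively_flat_def metrically_flat_def extremely_flat_def by blast
qed

end
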